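(* Let $G$ be a locally compact, $\sigma$-compact abelian group whose topology has a countable basis, and let $(X,G,m)$ be an ergodic dynamical system. Let $(B_n)$ be a van Hove sequence in $G$ along which the Birkhoff ergodic theorem holds. Let $f:X\to\mathbb{C}$ be continuous. Then the measures $$\gamma^f_{x,n}:=\frac{1}{m_G(B_n)}\,\mu^f_x|_{B_n}\ast\widetilde{\mu^f_x|_{B_n}}$$ converge vaguely to $\gamma^f$ as $n\to\infty$ for $m$-almost every $x\in X$.
   Context: $G$ is written additively, with Haar measure $m_G$ (also written $|\cdot|$). A dynamical system $(X,G,m)$ consists of a compact (Hausdorff) space $X$ with a continuous action $(t,x)\mapsto\alpha_t(x)$ of $G$ and a $G$-invariant (Radon) probability measure $m$ on $X$; it is ergodic if every invariant measurable set has measure $0$ or $1$. $\langle f,g\rangle=\int_X f\overline g\,dm$ and $T_tf=f\circ\alpha_{-t}$. For $f\in C(X)$ and $x\in X$, $\mu^f_x$ is the measure on $G$ with density $t\mapsto f(\alpha_{-t}x)$ with respect to $m_G$, and $\mu^f_x|_{B}$ is its restriction to $B$. For a finite measure $\mu$ on $G$, $\widetilde\mu(\varphi)=\overline{\mu(\widetilde\varphi)}$ where $\widetilde\varphi(t)=\overline{\varphi(-t)}$, and $\ast$ denotes convolution of measures. Vague convergence means convergence when integrated against every $\varphi\in C_c(G)$. For $f\in L^2(X,m)$ let $\mathcal{N}^f(\varphi)=\int_G\varphi(t)\,T_tf\,dm_G(t)$ for $\varphi\in C_c(G)$. The autocorrelation $\gamma^f$ is the unique measure on $G$ with $\gamma^f(\varphi\ast\widetilde\psi)=\langle\mathcal{N}^f(\varphi),\mathcal{N}^f(\psi)\rangle$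 for all $\varphi,\psi\in C_c(G)$, where $(\varphi\ast\psi)(t)=\int_G\varphi(t-s)\psi(s)\,dm_G(s)$. A sequence $(B_n)$ of compact subsets of $G$ (of positive Haar measure) is a van Hove sequence if $\lim_{n\to\infty}|\partial^KB_n|/|B_n|=0$ for every compact $K\subset G$, where $\partial^KB:=\overline{((B+K)\setminus B)}\cup((\overline{G\setminus B}-K)\cap B)$. The Birkhoff ergodic theorem holds along $(B_n)$ if for every $F\in L^1(X,m)$ one has $\frac{1}{m_G(B_n)}\int_{B_n}F(\alpha_{-t}x)\,dm_G(t)\to\int_XF\,dm$ for $m$-almost every $x\in X$. *)

theory Defs
  imports "HOL-Probability.Probability_Measure"
begin

section \<open>Radon and Haar measures\<close>

definition radon_measure :: "'a::t2_space measure \<Rightarrow> bool" where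
  "radon_measure M \<longleftrightarrow>
     sets M = sets borel \<and>
     (\<forall>K. compact K \<longrightarrow> emeasure M K < \<infinity>) \<and>
     (\<forall>A\<in>sets borel. emeasure M A = (INF U\<in>{U. open U \<and> A \<subseteq> U}. emeasure M U)) \<and>
     (\<forall>U. open U \<longrightarrow> emeasure M U = (SUP K\<in>{K. compact K \<and> K \<subseteq> U}. emeasure M K))"

definition haar_measure :: "'g::{topological_ab_group_add, t2_space} measure \<Rightarrow> bool" where
  "haar_measure M \<longleftrightarrow>
     radon_measure M \<and> emeasure M UNIV \<noteq> 0 \<and>
     (\<forall>t. \<forall>A\<in>sets borel. emeasure M ((\<lambda>s. t + s) ` A) = emeasure M A)"

definition sigma_compact :: "'a::topological_space set \<Rightarrow> bool" where
  "sigma_compact S \<longleftrightarrow> (\<exists>K :: nat \<Rightarrow> 'a set. (\<forall>n. compact (K n)) \<and> S = (\<Union>n. K n))"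


section \<open>Dynamical systems\<close>

definition dynamical_system ::
  "('g::{topological_ab_group_add, t2_space} \<Rightarrow> 'x::t2_space \<Rightarrow> 'x) \<Rightarrow> 'x measure \<Rightarrow> bool" where
  "dynamical_system \<alpha> m \<longleftrightarrow>
     compact (UNIV :: 'x set) \<and>
     continuous_on UNIV (\<lambda>(t, x). \<alpha> t x) \<and>
     (\<forall>x. \<alpha> 0 x = x) \<and> (\<forall>s t x. \<alpha> (s + t) x = \<alpha> s (\<alpha> t x)) \<and>
     radon_measure m \<and> prob_space m \<and>
     (\<forall>t. \<forall>A\<in>sets m. emeasure m (\<alpha> t ` A) = emeasure m A)"

definition ergodic_system ::
  "('g::{topological_ab_group_add, t2_space} \<Rightarrow> 'x::t2_space \<Rightarrow> 'x) \<Rightarrow> 'x measure \<Rightarrow> bool" where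
  "ergodic_system \<alpha> m \<longleftrightarrow>
     dynamical_system \<alpha> m \<and>
     (\<forall>A\<in>sets m. (\<forall>t. \<alpha> t ` A = A) \<longrightarrow> measure m A = 0 \<or> measure m A = 1)"

definition L2_inner :: "'x measure \<Rightarrow> ('x \<Rightarrow> complex) \<Rightarrow> ('x \<Rightarrow> complex) \<Rightarrow> complex" where
  "L2_inner m f g = (LINT x|m. f x * cnj (g x))"

definition koopman :: "('g::group_add \<Rightarrow> 'x \<Rightarrow> 'x) \<Rightarrow> 'g \<Rightarrow> ('x \<Rightarrow> complex) \<Rightarrow> 'x \<Rightarrow> complex" where
  "koopman \<alpha> t f = f \<circ> \<alpha> (- t)"


section \<open>Averaging sequences\<close>

definition van_Hove_boundary ::
  "'g::topological_ab_group_add set \<Rightarrow> 'g set \<Rightarrow> 'g set" where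
  "van_Hove_boundary K B =
     closure ({b + k | b k. b \<in> B \<and> k \<in> K} - B)
     \<union> ({c - k | c k. c \<in> closure (UNIV - B) \<and> k \<in> K} \<inter> B)"

definition van_Hove_sequence ::
  "'g::topological_ab_group_add measure \<Rightarrow> (nat \<Rightarrow> 'g set) \<Rightarrow> bool" where
  "van_Hove_sequence mG B \<longleftrightarrow>
     (\<forall>n. compact (B n) \<and> measure mG (B n) > 0) \<and>
     (\<forall>K. compact K \<longrightarrow>
        (\<lambda>n. measure mG (van_Hove_boundary K (B n)) / measure mG (B n)) \<longlonglongrightarrow> 0)"

definition birkhoff_along ::
  "'g::group_add measure \<Rightarrow> ('g \<Rightarrow> 'x \<Rightarrow> 'x) \<Rightarrow> 'x measure \<Rightarrow> (nat \<Rightarrow> 'g set) \<Rightarrow> bool" where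
  "birkhoff_along mG \<alpha> m B \<longleftrightarrow>
     (\<forall>F :: 'x \<Rightarrow> complex. integrable m F \<longrightarrow>
        (AE x in m.
          (\<lambda>n. complex_of_real (1 / measure mG (B n)) * (LINT t:B n|mG. F (\<alpha> (- t) x)))
            \<longlonglongrightarrow> (LINT x|m. F x)))"


section \<open>Complex measures on a group\<close>

text \<open>
  A complex Radon measure \<open>\<mu>\<close>, which in general takes no value on sets of infinite total
  variation, is represented by the functional \<open>\<phi> \<mapsto> \<mu>(\<phi>) = \<integral> \<phi> d\<mu>\<close>.  By the Riesz representation
  theorem these are the linear functionals on \<open>C\<^sub>c(G)\<close> that are bounded on the functions supported
  in any fixed compact set.  A measure given by a density is the full integration functional, so it
  can also be applied to discontinuous integrands such as \<open>1\<^sub>B \<phi>\<close>.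
\<close>

definition Cc :: "('g::topological_space \<Rightarrow> complex) set" where
  "Cc = {\<phi>. continuous_on UNIV \<phi> \<and> compact (closure {t. \<phi> t \<noteq> 0})}"

definition complex_radon_functional ::
  "(('g::topological_space \<Rightarrow> complex) \<Rightarrow> complex) \<Rightarrow> bool" where
  "complex_radon_functional \<mu> \<longleftrightarrow>
     (\<forall>\<phi>\<in>Cc. \<forall>\<psi>\<in>Cc. \<mu> (\<lambda>t. \<phi> t + \<psi> t) = \<mu> \<phi> + \<mu> \<psi>) \<and>
     (\<forall>c. \<forall>\<phi>\<in>Cc. \<mu> (\<lambda>t. c * \<phi> t) = c * \<mu> \<phi>) \<and>
     (\<forall>K. compact K \<longrightarrow>
        (\<exists>C. \<forall>\<phi>\<in>Cc. closure {t. \<phi> t \<noteq> 0} \<subseteq> K \<longrightarrow> norm (\<mu> \<phi>) \<le> C * (SUP t. norm (\<phi> t))))"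

definition density_functional ::
  "'g measure \<Rightarrow> ('g \<Rightarrow> complex) \<Rightarrow> ('g \<Rightarrow> complex) \<Rightarrow> complex" where
  "density_functional M h = (\<lambda>\<phi>. LINT t|M. \<phi> t * h t)"

definition restrict_functional ::
  "(('g \<Rightarrow> complex) \<Rightarrow> complex) \<Rightarrow> 'g set \<Rightarrow> ('g \<Rightarrow> complex) \<Rightarrow> complex" where
  "restrict_functional \<mu> B = (\<lambda>\<phi>. \<mu> (\<lambda>t. indicator B t * \<phi> t))"

definition tilde_fun :: "('g::group_add \<Rightarrow> complex) \<Rightarrow> 'g \<Rightarrow> complex" where
  "tilde_fun \<phi> = (\<lambda>t. cnj (\<phi> (- t)))"

definition tilde_functional ::
  "(('g::group_add \<Rightarrow> complex) \<Rightarrow> complex) \<Rightarrow> ('g \<Rightarrow> complex) \<Rightarrow> complex" where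
  "tilde_functional \<mu> = (\<lambda>\<phi>. cnj (\<mu> (tilde_fun \<phi>)))"

definition conv_fun ::
  "'g::group_add measure \<Rightarrow> ('g \<Rightarrow> complex) \<Rightarrow> ('g \<Rightarrow> complex) \<Rightarrow> 'g \<Rightarrow> complex" where
  "conv_fun mG \<phi> \<psi> = (\<lambda>t. LINT s|mG. \<phi> (t - s) * \<psi> s)"

text \<open>\<open>(\<mu> * \<nu>)(\<phi>) = \<integral>\<integral> \<phi>(s + t) d\<nu>(t) d\<mu>(s)\<close>.\<close>

definition conv_functional ::
  "(('g::group_add \<Rightarrow> complex) \<Rightarrow> complex) \<Rightarrow> (('g \<Rightarrow> complex) \<Rightarrow> complex)
     \<Rightarrow> ('g \<Rightarrow> complex) \<Rightarrow> complex" where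
  "conv_functional \<mu> \<nu> = (\<lambda>\<phi>. \<mu> (\<lambda>s. \<nu> (\<lambda>t. \<phi> (s + t))))"

definition vaguely_converges ::
  "(nat \<Rightarrow> ('g::topological_space \<Rightarrow> complex) \<Rightarrow> complex)
     \<Rightarrow> (('g \<Rightarrow> complex) \<Rightarrow> complex) \<Rightarrow> bool" where
  "vaguely_converges \<mu>s \<mu> \<longleftrightarrow> (\<forall>\<phi>\<in>Cc. (\<lambda>n. \<mu>s n \<phi>) \<longlonglongrightarrow> \<mu> \<phi>)"


section \<open>Autocorrelation\<close>

text \<open>
  The \<open>L\<^sup>2\<close>-valued integral \<open>\<integral> \<phi>(t) T\<^sub>t f dt\<close> is given by its pointwise representative.
\<close>

definition smear ::
  "'g::group_add measure \<Rightarrow> ('g \<Rightarrow> 'x \<Rightarrow> 'x) \<Rightarrow> ('x \<Rightarrow> complex) \<Rightarrow> ('g \<Rightarrow> complex) \<Rightarrow> 'x \<Rightarrow> complex"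
  where "smear mG \<alpha> f \<phi> = (\<lambda>x. LINT t|mG. \<phi> t * koopman \<alpha> t f x)"

text \<open>
  A functional is a HOL function on all of \<^typ>\<open>'g \<Rightarrow> complex\<close>; fixing its values outside \<open>C\<^sub>c(G)\<close>
  by extensionality is what makes the description by \<open>THE\<close> unique.
\<close>

definition autocorrelation ::
  "'g::topological_ab_group_add measure \<Rightarrow> ('g \<Rightarrow> 'x \<Rightarrow> 'x) \<Rightarrow> 'x measure \<Rightarrow> ('x \<Rightarrow> complex)
     \<Rightarrow> ('g \<Rightarrow> complex) \<Rightarrow> complex" where
  "autocorrelation mG \<alpha> m f =
     (THE \<gamma>. \<gamma> \<in> extensional Cc \<and> complex_radon_functional \<gamma> \<and>
        (\<forall>\<phi>\<in>Cc. \<forall>\<psi>\<in>Cc. \<gamma> (conv_fun mG \<phi> (tilde_fun \<psi>))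
                            = L2_inner m (smear mG \<alpha> f \<phi>) (smear mG \<alpha> f \<psi>)))"

definition orbit_measure ::
  "'g::group_add measure \<Rightarrow> ('g \<Rightarrow> 'x \<Rightarrow> 'x) \<Rightarrow> ('x \<Rightarrow> complex) \<Rightarrow> 'x
     \<Rightarrow> ('g \<Rightarrow> complex) \<Rightarrow> complex" where
  "orbit_measure mG \<alpha> f x = density_functional mG (\<lambda>t. f (\<alpha> (- t) x))"

definition empirical_autocorrelation ::
  "'g::group_add measure \<Rightarrow> ('g \<Rightarrow> 'x \<Rightarrow> 'x) \<Rightarrow> ('x \<Rightarrow> complex) \<Rightarrow> 'x \<Rightarrow> 'g set
     \<Rightarrow> ('g \<Rightarrow> complex) \<Rightarrow> complex" where
  "empirical_autocorrelation mG \<alpha> f x B =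
     (let \<mu> = restrict_functional (orbit_measure mG \<alpha> f x) B
      in (\<lambda>\<phi>. complex_of_real (1 / measure mG B) * conv_functional \<mu> (tilde_functional \<mu>) \<phi>))"

end

theory Submission
  imports Defs
begin

text \<open>
  With \<open>c(u) = \<langle>T\<^sub>u f, f\<rangle>\<close>, the autocorrelation is the measure with density \<open>c\<close>; uniqueness follows from
  an approximate identity.  For \<open>\<phi> \<in> C\<^sub>c(G)\<close> the van Hove property allows one to replace the integral over
  \<open>B\<^sub>n \<times> B\<^sub>n\<close> defining \<open>\<gamma>\<^sup>f\<^sub>x\<^sub>,\<^sub>n(\<phi>)\<close> by one over \<open>G \<times> B\<^sub>n\<close>, which turns it into
  \<open>\<integral> \<phi>(u) A\<^sub>n(u, x) du\<close>, where \<open>A\<^sub>n(u, x)\<close> is the average over \<open>t \<in> B\<^sub>n\<close> of \<open>(T\<^sub>u f \<cdot> cnj f)(\<alpha>\<^sub>-\<^sub>t x)\<close>.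
  For each \<open>u\<close>, Birkhoff's theorem gives \<open>A\<^sub>n(u, x) \<rightarrow> c(u)\<close> for almost every \<open>x\<close>.  By Fubini, for almost every \<open>x\<close>
  this holds for almost every \<open>u\<close>, and dominated convergence then handles every \<open>\<phi>\<close> at once: the
  exceptional null set does not depend on \<open>\<phi>\<close>, and no separability of \<open>C\<^sub>c(G)\<close> is needed.
\<close>

section \<open>Measurability and integrability on products\<close>

text \<open>Only the first factor has a countable base, since X need not be metrisable. For each
  basic open U take \<open>V U\<close>, the largest open set with U x \<open>V U\<close> inside W.
  These countably many open rectangles already exhaust W.\<close>

lemma open_in_sets_pair_borel:
  fixes W :: "('g::second_countable_topology \<times> 'x::topological_space) set"
  assumes "open W"
  shows "W \<in> sets (borel \<Otimes>\<^sub>M borel)"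
proof -
  obtain \<B> :: "'g set set" where \<B>: "countable \<B>" "topological_basis \<B>"
    using ex_countable_basis by blast
  define V where "V U = \<Union>{V. open V \<and> U \<times> V \<subseteq> W}" for U
  have W: "W = (\<Union>U\<in>\<B>. U \<times> V U)"
  proof
    show "(\<Union>U\<in>\<B>. U \<times> V U) \<subseteq> W"
      unfolding V_def by blast
    show "W \<subseteq> (\<Union>U\<in>\<B>. U \<times> V U)"
    proof
      fix z assume "z \<in> W"
      then obtain A C where AC: "open A" "open C" "z \<in> A \<times> C" "A \<times> C \<subseteq> W"
        using open_prod_elim[OF assms] by metis
      then obtain U where U: "U \<in> \<B>" "fst z \<in> U" "U \<subseteq> A"
        using \<B>(2) by (metis mem_Times_iff topological_basisE)
      with AC have "C \<subseteq> V U"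
        unfolding V_def by blast
      with U AC show "z \<in> (\<Union>U\<in>\<B>. U \<times> V U)"
        by (auto simp: mem_Times_iff)
    qed
  qed
  have "open (V U)" for U
    unfolding V_def by auto
  moreover have "open U" if "U \<in> \<B>" for U
    using \<B>(2) that by (rule topological_basis_open)
  ultimately have "U \<times> V U \<in> sets (borel \<Otimes>\<^sub>M borel)" if "U \<in> \<B>" for U
    using that by (intro pair_measureI) auto
  then have "(\<Union>U\<in>\<B>. U \<times> V U) \<in> sets (borel \<Otimes>\<^sub>M borel)"
    using \<B>(1) by (intro sets.countable_UN') auto
  then show ?thesis
    using W by simp
qed

lemma borel_measurable_pair_continuous:
  fixes g :: "'g::second_countable_topology \<times> 'x::topological_space \<Rightarrow> 'b::topological_space"
  assumes "continuous_on UNIV g"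
  shows "g \<in> borel_measurable (borel \<Otimes>\<^sub>M borel)"
  by (rule borel_measurableI)
    (use assms in \<open>auto simp: space_pair_measure intro!: open_in_sets_pair_borel open_vimage\<close>)

text \<open>A majorant of the form a(x) b(y) turns Fubini's integrability criterion into two
  one-variable integrals. It justifies the exchanges of integrals on G x G and G x X below.\<close>

lemma (in pair_sigma_finite) integrable_product_bound:
  fixes f :: "_ \<Rightarrow> _::{banach, second_countable_topology}"
  assumes [measurable]: "f \<in> borel_measurable (M1 \<Otimes>\<^sub>M M2)"
    and bound: "\<And>x y. norm (f (x, y)) \<le> a x * b y"
    and a: "integrable M1 a" and b: "integrable M2 b"
  shows "integrable (M1 \<Otimes>\<^sub>M M2) f"
proof (rule Fubini_integrable)
  have int: "integrable M2 (\<lambda>y. f (x, y))" if "x \<in> space M1" for x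
  proof (rule Bochner_Integration.integrable_bound)
    show "integrable M2 (\<lambda>y. a x * b y)"
      using b by simp
    show "(\<lambda>y. f (x, y)) \<in> borel_measurable M2"
      using that by measurable
    show "AE y in M2. norm (f (x, y)) \<le> norm (a x * b y)"
      by (intro AE_I2) (use bound abs_ge_self order_trans in \<open>unfold real_norm_def, blast\<close>)
  qed
  then show "AE x in M1. integrable M2 (\<lambda>y. f (x, y))"
    by auto
  show "integrable M1 (\<lambda>x. \<integral>y. norm (f (x, y)) \<partial>M2)"
  proof (rule Bochner_Integration.integrable_bound)
    show "integrable M1 (\<lambda>x. a x * (\<integral>y. b y \<partial>M2))"
      using a by simp
    show "(\<lambda>x. \<integral>y. norm (f (x, y)) \<partial>M2) \<in> borel_measurable M1"
      by measurable
    have "norm (\<integral>y. norm (f (x, y)) \<partial>M2) \<le> norm (a x * (\<integral>y. b y \<partial>M2))"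
      if "x \<in> space M1" for x
    proof -
      have "(\<integral>y. norm (f (x, y)) \<partial>M2) \<le> (\<integral>y. a x * b y \<partial>M2)"
        using int[OF that] b bound by (intro integral_mono) auto
      moreover have "0 \<le> (\<integral>y. norm (f (x, y)) \<partial>M2)"
        by simp
      ultimately show ?thesis
        by simp
    qed
    then show "AE x in M1. norm (\<integral>y. norm (f (x, y)) \<partial>M2) \<le> norm (a x * (\<integral>y. b y \<partial>M2))"
      by auto
  qed
qed measurable

lemma borel_measurable_cnj [measurable (raw)]:
  "g \<in> borel_measurable M \<Longrightarrow> (\<lambda>x. cnj (g x)) \<in> borel_measurable M"
  by (rule borel_measurable_continuous_on[OF continuous_on_cnj[OF continuous_on_id]])

text \<open>If f is not integrable, its Bochner integral is 0 by convention, and the bound holds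
  because g is nonnegative.\<close>

lemma norm_integral_le:
  fixes f :: "'a \<Rightarrow> 'b::{banach, second_countable_topology}"
  assumes "integrable M g" "\<And>x. norm (f x) \<le> g x"
  shows "norm (\<integral>x. f x \<partial>M) \<le> (\<integral>x. g x \<partial>M)"
proof -
  have "norm (\<integral>x. f x \<partial>M) \<le> (\<integral>x. norm (f x) \<partial>M)"
    by (rule integral_norm_bound)
  also have "\<dots> \<le> (\<integral>x. g x \<partial>M)"
    using assms(2) order_trans[OF norm_ge_zero assms(2)] by (intro integral_mono'[OF assms(1)])
  finally show ?thesis .
qed

section \<open>Translates, sums and differences of sets in a topological group\<close>

lemma translation_image_eq_vimage:
  fixes t :: "'g::group_add"
  shows "(\<lambda>s. t + s) ` A = (\<lambda>s. - t + s) -` A"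
proof (intro equalityI subsetI)
  fix s assume "s \<in> (\<lambda>s. - t + s) -` A"
  then show "s \<in> (\<lambda>s. t + s) ` A"
    by (intro image_eqI[of _ _ "- t + s"]) simp_all
qed auto

lemma compact_sum_set:
  fixes A K :: "'g::topological_monoid_add set"
  assumes "compact A" "compact K"
  shows "compact {b + k | b k. b \<in> A \<and> k \<in> K}"
proof -
  have "{b + k | b k. b \<in> A \<and> k \<in> K} = (\<lambda>p. fst p + snd p) ` (A \<times> K)"
    by (force simp: image_iff)
  moreover have "compact ((\<lambda>p. fst p + snd p) ` (A \<times> K))"
    by (intro compact_continuous_image compact_Times assms continuous_intros)
  ultimately show ?thesis
    by simp
qed

lemma compact_diff_set:
  fixes A K :: "'g::topological_group_add set"
  assumes "compact A" "compact K"
  shows "compact {b - k | b k. b \<in> A \<and> k \<in> K}"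
proof -
  have "{b - k | b k. b \<in> A \<and> k \<in> K} = (\<lambda>p. fst p - snd p) ` (A \<times> K)"
    by (force simp: image_iff)
  moreover have "compact ((\<lambda>p. fst p - snd p) ` (A \<times> K))"
    by (intro compact_continuous_image compact_Times assms continuous_intros)
  ultimately show ?thesis
    by simp
qed

section \<open>The space of continuous functions with compact support\<close>

lemma continuous_on_Cc: "\<phi> \<in> Cc \<Longrightarrow> continuous_on UNIV \<phi>"
  by (simp add: Cc_def)

lemma compact_support_Cc: "\<phi> \<in> Cc \<Longrightarrow> compact (closure {t. \<phi> t \<noteq> 0})"
  by (simp add: Cc_def)

lemma CcI:
  fixes \<phi> :: "'g::t2_space \<Rightarrow> complex"
  assumes "continuous_on UNIV \<phi>" "compact K" "\<And>t. t \<notin> K \<Longrightarrow> \<phi> t = 0"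
  shows "\<phi> \<in> Cc" "closure {t. \<phi> t \<noteq> 0} \<subseteq> K"
proof -
  show sub: "closure {t. \<phi> t \<noteq> 0} \<subseteq> K"
    using assms by (intro closure_minimal compact_imp_closed) auto
  then show "\<phi> \<in> Cc"
    using assms closed_Int_compact[of "closure {t. \<phi> t \<noteq> 0}" K] by (auto simp: Cc_def Int_absorb2)
qed

lemma CcE:
  assumes "\<phi> \<in> Cc"
  obtains K C where "compact K" "\<And>t. t \<notin> K \<Longrightarrow> \<phi> t = 0" "0 \<le> C" "\<And>t. norm (\<phi> t) \<le> C"
proof -
  let ?K = "closure {t. \<phi> t \<noteq> 0}"
  have K: "compact ?K" "\<And>t. t \<notin> ?K \<Longrightarrow> \<phi> t = 0"
    using compact_support_Cc[OF assms] closure_subset[of "{t. \<phi> t \<noteq> 0}"] by auto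
  have "compact (\<phi> ` ?K)"
    using K(1) continuous_on_Cc[OF assms] by (metis compact_continuous_image continuous_on_subset top_greatest)
  then obtain C where "\<And>t. t \<in> ?K \<Longrightarrow> norm (\<phi> t) \<le> C"
    by (metis bounded_iff compact_imp_bounded imageI)
  then have "norm (\<phi> t) \<le> max 0 C" for t
    using K(2)[of t] by (cases "t \<in> ?K") (auto simp: le_max_iff_disj)
  then show thesis
    by (intro that[OF K, of "max 0 C"]) auto
qed

lemma borel_measurable_Cc: "\<phi> \<in> Cc \<Longrightarrow> \<phi> \<in> borel_measurable borel"
  by (simp add: borel_measurable_continuous_onI continuous_on_Cc)

lemma tilde_fun_Cc:
  fixes \<phi> :: "'g::{topological_group_add, t2_space} \<Rightarrow> complex"
  assumes "\<phi> \<in> Cc"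
  shows "tilde_fun \<phi> \<in> Cc"
proof -
  obtain K C where K: "compact K" "\<And>t. t \<notin> K \<Longrightarrow> \<phi> t = 0"
    using CcE[OF assms] by metis
  show ?thesis
  proof (rule CcI(1))
    show "continuous_on UNIV (tilde_fun \<phi>)"
      unfolding tilde_fun_def
      by (intro continuous_intros continuous_on_compose2[OF continuous_on_Cc[OF assms]]) auto
    show "compact (uminus ` K)"
      using K(1) by (intro compact_continuous_image continuous_intros)
    show "tilde_fun \<phi> t = 0" if "t \<notin> uminus ` K" for t
    proof -
      have "- t \<notin> K"
      proof
        assume "- t \<in> K"
        then have "- (- t) \<in> uminus ` K"
          by (rule imageI)
        with that show False
          by simp
      qed
      then show ?thesis
        using K(2) by (simp add: tilde_fun_def)
    qed
  qed
qed

lemma complex_eq_if_norm_diff_le: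
  assumes "\<And>\<epsilon>::real. \<epsilon> > 0 \<Longrightarrow> norm (a - b :: complex) \<le> C * \<epsilon>"
  shows "a = b"
proof (rule ccontr)
  assume "a \<noteq> b"
  then have pos: "norm (a - b) > 0"
    by simp
  \<comment> \<open>This choice of \<epsilon> makes the right-hand side at most half of |a - b|,
    whatever the sign of C.\<close>
  have "norm (a - b) \<le> C * (norm (a - b) / (2 * (\<bar>C\<bar> + 1)))"
    using pos by (intro assms) (auto intro!: divide_pos_pos)
  also have "\<dots> \<le> (\<bar>C\<bar> + 1) * (norm (a - b) / (2 * (\<bar>C\<bar> + 1)))"
    by (intro mult_right_mono) (use pos in auto)
  also have "\<dots> = norm (a - b) / 2"
    by (simp add: field_simps)
  finally show False
    using pos by simp
qed

text \<open>Uniform continuity on a topological group, which carries no uniform structure of its own here.\<close>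

lemma Cc_uniformly_continuous:
  fixes \<phi> :: "'g::{topological_ab_group_add, t2_space} \<Rightarrow> complex"
  assumes "\<phi> \<in> Cc" "\<epsilon> > 0" and L: "open V" "compact L" "0 \<in> V" "V \<subseteq> L"
  obtains U where "open U" "0 \<in> U" "U \<subseteq> V" "\<And>v t. v \<in> U \<Longrightarrow> norm (\<phi> (t - v) - \<phi> t) < \<epsilon>"
proof -
  obtain K C where K: "compact K" "\<And>t. t \<notin> K \<Longrightarrow> \<phi> t = 0"
    using CcE[OF assms(1)] by metis
  \<comment> \<open>If t lies outside K + L and outside K, then neither t nor any t - v with v in L
    meets K, so the difference vanishes there and only t in this compact set needs control.\<close>
  let ?S = "K \<union> {k + l | k l. k \<in> K \<and> l \<in> L}"
  have S: "compact ?S"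
    by (intro compact_Un K L compact_sum_set)
  define W where "W = {p. norm (\<phi> (snd p - fst p) - \<phi> (snd p)) < \<epsilon>}"
  have "open W"
    unfolding W_def
    by (intro open_Collect_less continuous_intros continuous_on_compose2[OF continuous_on_Cc[OF assms(1)]]) auto
  moreover have "{0} \<times> ?S \<subseteq> W"
    using assms(2) by (auto simp: W_def)
  \<comment> \<open>The tube lemma, by compactness of the second factor, yields one neighbourhood of
    0 that works for all t in the compact set simultaneously.\<close>
  ultimately obtain X where X: "0 \<in> X" "open X" "X \<times> ?S \<subseteq> W"
    using Elementary_Topology.tube_lemma[OF S, of W 0] by blast
  show thesis
  proof
    show "open (X \<inter> V)" "0 \<in> X \<inter> V" "X \<inter> V \<subseteq> V"
      using X L by auto
    fix v t assume v: "v \<in> X \<inter> V"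
    show "norm (\<phi> (t - v) - \<phi> t) < \<epsilon>"
    proof (cases "t \<in> ?S")
      case True
      then have "(v, t) \<in> W"
        using X v by blast
      then show ?thesis
        by (simp add: W_def)
    next
      case False
      then have "t \<notin> K"
        by auto
      moreover have "t - v \<notin> K"
      proof
        assume "t - v \<in> K"
        moreover have "t = (t - v) + v" "v \<in> L"
          using v L by auto
        ultimately show False
          using False by blast
      qed
      ultimately show ?thesis
        using K(2) assms(2) by simp
    qed
  qed
qed

section \<open>Haar measure: sigma-finiteness, translation and inversion\<close>

locale haar_group =
  fixes mG :: "'g::{topological_ab_group_add, t2_space, second_countable_topology} measure"
  assumes locally_compact: "locally_compact_space (euclidean :: 'g topology)"
    and sigma_compact: "sigma_compact (UNIV :: 'g set)"
    and haar: "haar_measure mG"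
begin

lemma sets_haar [measurable_cong, simp]: "sets mG = sets borel"
  using haar by (simp add: haar_measure_def radon_measure_def)

lemma space_haar [simp]: "space mG = UNIV"
  using sets_eq_imp_space_eq[OF sets_haar] by simp

lemma emeasure_compact_finite: "compact K \<Longrightarrow> emeasure mG K < \<infinity>"
  using haar by (simp add: haar_measure_def radon_measure_def)

lemma compact_sets: "compact K \<Longrightarrow> K \<in> sets (borel :: 'g measure)"
  by (simp add: borel_closed compact_imp_closed)

text \<open>Countably many compact sets cover G, and each has finite Haar measure. Fubini's theorem
  on G x G and on G x X rests on this.\<close>

sublocale sigma_finite_measure mG
proof
  obtain K :: "nat \<Rightarrow> 'g set" where K: "\<And>n. compact (K n)" "UNIV = (\<Union>n. K n)"
    using sigma_compact unfolding sigma_compact_def by auto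
  show "\<exists>A. countable A \<and> A \<subseteq> sets mG \<and> \<Union>A = space mG \<and> (\<forall>a\<in>A. emeasure mG a \<noteq> \<infinity>)"
    using K emeasure_compact_finite compact_sets
    by (intro exI[of _ "range K"]) (auto simp: less_top)
qed

sublocale GG: pair_sigma_finite mG mG ..

text \<open>Subtraction is continuous on G x G, and the countable base of G places the open subsets
  of G x G in the product sigma-algebra.\<close>

lemma measurable_group_diff [measurable (raw)]:
  assumes "g \<in> borel_measurable M" "h \<in> borel_measurable M"
  shows "(\<lambda>x. g x - h x :: 'g) \<in> borel_measurable M"
proof -
  have "(\<lambda>p. fst p - snd p :: 'g) \<in> borel_measurable (borel \<Otimes>\<^sub>M borel)"
    by (intro borel_measurable_pair_continuous continuous_intros)
  from measurable_compose[OF measurable_Pair[OF assms] this] show ?thesis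
    by simp
qed

lemma measurable_group_uminus [measurable (raw)]:
  assumes "h \<in> borel_measurable M"
  shows "(\<lambda>x. - h x :: 'g) \<in> borel_measurable M"
  using measurable_group_diff[OF _ assms, of "\<lambda>_. 0"] by simp

lemma distr_translation: "distr mG borel (\<lambda>s. t + s) = mG"
proof (rule measure_eqI)
  fix A assume "A \<in> sets (distr mG borel (\<lambda>s. t + s))"
  then have A: "A \<in> sets borel"
    by simp
  have "(\<lambda>s. t + s) -` A = (\<lambda>s. - t + s) ` A"
    using translation_image_eq_vimage[of "- t" A] by simp
  moreover have "emeasure mG ((\<lambda>s. - t + s) ` A) = emeasure mG A"
    using haar A unfolding haar_measure_def by blast
  ultimately show "emeasure (distr mG borel (\<lambda>s. t + s)) A = emeasure mG A"
    using A by (subst emeasure_distr) auto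
qed simp

lemma nn_integral_translation:
  "g \<in> borel_measurable borel \<Longrightarrow> (\<integral>\<^sup>+s. g (t + s) \<partial>mG) = (\<integral>\<^sup>+s. g s \<partial>mG)"
  using nn_integral_distr[of "\<lambda>s. t + s" mG borel g] by (simp add: distr_translation)

lemma exists_compact_pos: "\<exists>K. compact K \<and> emeasure mG K \<noteq> 0"
proof -
  obtain K :: "nat \<Rightarrow> 'g set" where K: "\<And>n. compact (K n)" "UNIV = (\<Union>n. K n)"
    using sigma_compact unfolding sigma_compact_def by auto
  show ?thesis
  proof (rule ccontr)
    assume "\<not> ?thesis"
    then have "K n \<in> null_sets mG" for n
      using K(1) compact_sets by auto
    then have "(\<Union>n. K n) \<in> null_sets mG"
      by blast
    then show False
      using haar K(2) by (simp add: haar_measure_def null_sets_def)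
  qed
qed

text \<open>For \<open>\<psi>\<close> the indicator of a compact set of positive measure, Fubini and translation invariance
  give \<open>\<integral>\<phi>(-s) ds \<integral>\<psi> = \<integral>\<integral> \<phi>(t - s) \<psi>(t) ds dt = \<integral>\<integral> \<phi>(t) \<psi>(t + s) dt ds = \<integral>\<phi> \<integral>\<psi>\<close>.\<close>

lemma nn_integral_inversion:
  assumes [measurable]: "g \<in> borel_measurable borel"
  shows "(\<integral>\<^sup>+s. g (- s) \<partial>mG) = (\<integral>\<^sup>+s. g s \<partial>mG)"
proof -
  obtain K where K: "compact K" "emeasure mG K \<noteq> 0"
    using exists_compact_pos by auto
  have [measurable]: "K \<in> sets borel"
    using K(1) by (rule compact_sets)
  let ?k = "\<lambda>t. indicator K t :: ennreal"
  have [simp]: "(\<integral>\<^sup>+t. ?k t \<partial>mG) = emeasure mG K"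
    by simp
  have "(\<integral>\<^sup>+s. g (- s) \<partial>mG) * emeasure mG K = (\<integral>\<^sup>+t. (\<integral>\<^sup>+s. g (- s) \<partial>mG) * ?k t \<partial>mG)"
    by (subst nn_integral_cmult) auto
  also have "\<dots> = (\<integral>\<^sup>+t. (\<integral>\<^sup>+s. g (t - s) \<partial>mG) * ?k t \<partial>mG)"
    using nn_integral_translation[of "\<lambda>s. g (- s)" "- t" for t] by simp
  also have "\<dots> = (\<integral>\<^sup>+t. (\<integral>\<^sup>+s. g (t - s) * ?k t \<partial>mG) \<partial>mG)"
    by (subst nn_integral_multc) auto
  also have "\<dots> = (\<integral>\<^sup>+s. (\<integral>\<^sup>+t. g (t - s) * ?k t \<partial>mG) \<partial>mG)"
    by (rule GG.Fubini') measurable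
  also have "\<dots> = (\<integral>\<^sup>+s. (\<integral>\<^sup>+t. g t * ?k (t + s) \<partial>mG) \<partial>mG)"
  proof (rule nn_integral_cong)
    fix s
    show "(\<integral>\<^sup>+t. g (t - s) * ?k t \<partial>mG) = (\<integral>\<^sup>+t. g t * ?k (t + s) \<partial>mG)"
      using nn_integral_translation[of "\<lambda>t. g (t - s) * ?k t" s] by (simp add: add.commute)
  qed
  also have "\<dots> = (\<integral>\<^sup>+t. (\<integral>\<^sup>+s. g t * ?k (t + s) \<partial>mG) \<partial>mG)"
    by (rule GG.Fubini') measurable
  also have "\<dots> = (\<integral>\<^sup>+t. g t * (\<integral>\<^sup>+s. ?k (t + s) \<partial>mG) \<partial>mG)"
    by (subst nn_integral_cmult) auto
  also have "\<dots> = (\<integral>\<^sup>+t. g t * emeasure mG K \<partial>mG)"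
    by (subst nn_integral_translation) auto
  also have "\<dots> = (\<integral>\<^sup>+t. g t \<partial>mG) * emeasure mG K"
    by (subst nn_integral_multc) auto
  \<comment> \<open>The measure of K is neither 0 nor infinite, so it cancels in the extended
    reals.\<close>
  finally show ?thesis
    using K emeasure_compact_finite[OF K(1)] by (auto simp: ennreal_mult_cancel_left mult.commute[of _ "emeasure mG K"])
qed

lemma distr_inversion: "distr mG borel uminus = mG"
proof (rule measure_eqI)
  fix A assume "A \<in> sets (distr mG borel uminus)"
  then have A [measurable]: "A \<in> sets borel"
    by simp
  have "emeasure (distr mG borel uminus) A = (\<integral>\<^sup>+s. indicator A s \<partial>distr mG borel uminus)"
    by simp
  also have "\<dots> = (\<integral>\<^sup>+s. indicator A (- s) \<partial>mG)"
    by (rule nn_integral_distr) auto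
  also have "\<dots> = emeasure mG A"
    using A by (subst nn_integral_inversion) auto
  finally show "emeasure (distr mG borel uminus) A = emeasure mG A" .
qed simp

lemma
  fixes h :: "'g \<Rightarrow> 'b::{banach, second_countable_topology}"
  assumes [measurable]: "h \<in> borel_measurable borel"
  shows integral_translation: "(LINT s|mG. h (t + s)) = (LINT s|mG. h s)"
    and integral_inversion: "(LINT s|mG. h (- s)) = (LINT s|mG. h s)"
    and integrable_translation: "integrable mG (\<lambda>s. h (t + s)) \<longleftrightarrow> integrable mG h"
    and integrable_inversion: "integrable mG (\<lambda>s. h (- s)) \<longleftrightarrow> integrable mG h"
  using integral_distr[of "\<lambda>s. t + s" mG borel h] integral_distr[of uminus mG borel h]
    integrable_distr_eq[of "\<lambda>s. t + s" mG borel h] integrable_distr_eq[of uminus mG borel h]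
  by (simp_all add: distr_translation distr_inversion)

lemma integrable_Cc:
  assumes "\<phi> \<in> Cc"
  shows "integrable mG \<phi>"
proof -
  obtain K C where K: "compact K" "\<And>t. t \<notin> K \<Longrightarrow> \<phi> t = 0" "\<And>t. norm (\<phi> t) \<le> C"
    using CcE[OF assms] by metis
  show ?thesis
  proof (rule integrableI_bounded_set)
    show "K \<in> sets mG" "emeasure mG K < \<infinity>"
      using K(1) compact_sets emeasure_compact_finite by auto
    show "\<phi> \<in> borel_measurable mG"
      using borel_measurable_Cc[OF assms] by simp
    show "AE t in mG. t \<in> K \<longrightarrow> norm (\<phi> t) \<le> C" "AE t in mG. t \<notin> K \<longrightarrow> \<phi> t = 0"
      using K(2,3) by simp_all
  qed
qed

section \<open>Positivity on open sets and bump functions\<close>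

text \<open>The translates of U cover G, and by the Lindelof property countably many suffice. If U
  were null, invariance would make all of G null.\<close>

lemma open_pos:
  assumes "open U" "0 \<in> U"
  shows "emeasure mG U \<noteq> 0"
proof
  assume null: "emeasure mG U = 0"
  have op: "open ((\<lambda>s. t + s) ` U)" for t
  proof -
    show ?thesis
      unfolding translation_image_eq_vimage
      using assms(1) by (intro open_vimage continuous_intros)
  qed
  obtain \<F> where \<F>: "\<F> \<subseteq> range (\<lambda>t. (\<lambda>s. t + s) ` U)" "countable \<F>"
      "\<Union>\<F> = \<Union>(range (\<lambda>t. (\<lambda>s. t + s) ` U))"
    by (rule Lindelof[of "range (\<lambda>t. (\<lambda>s. t + s) ` U)"]) (use op in auto)
  have "t \<in> (\<lambda>s. t + s) ` U" for t
    by (rule image_eqI[of _ _ 0]) (use assms(2) in auto)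
  then have "\<Union>(range (\<lambda>t. (\<lambda>s. t + s) ` U)) = UNIV"
    by blast
  moreover have "A \<in> null_sets mG" if A: "A \<in> \<F>" for A
  proof -
    obtain t where t: "A = (\<lambda>s. t + s) ` U"
      using \<F>(1) A by blast
    have "emeasure mG A = emeasure mG U"
      using haar assms(1) unfolding t haar_measure_def by auto
    then show ?thesis
      using null op[of t] t by auto
  qed
  then have "\<Union>\<F> \<in> null_sets mG"
    using \<F>(2) null_sets_UN'[of \<F> "\<lambda>x. x" mG] by simp
  ultimately show False
    using haar \<F>(3) by (simp add: haar_measure_def null_sets_def)
qed

text \<open>Locally compact Hausdorff spaces are completely regular, so some continuous h with
  values in [0, 1] has h(0) = 1 and vanishes off U. Its integral is positive because {h \<noteq> 0}
  is an open neighbourhood of 0; dividing by it normalises h.\<close>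

lemma bump_function:
  assumes "open U" "0 \<in> U" "compact L" "U \<subseteq> L"
  obtains \<psi> :: "'g \<Rightarrow> real" where
    "(\<lambda>t. complex_of_real (\<psi> t)) \<in> Cc" "\<And>t. 0 \<le> \<psi> t" "\<And>t. t \<notin> U \<Longrightarrow> \<psi> t = 0"
    "integrable mG \<psi>" "(LINT t|mG. \<psi> t) = 1"
proof -
  have "Hausdorff_space (euclidean :: 'g topology)"
    by (metis Hausdorff_space_def disjnt_def hausdorff open_openin)
  then have "completely_regular_space (euclidean :: 'g topology)"
    using locally_compact by (simp add: locally_compact_regular_imp_completely_regular_space)
  moreover have "closedin euclidean (- U)"
    using assms(1) by (metis closed_Compl closed_closedin)
  moreover have "0 \<in> topspace euclidean - (- U)"
    using assms(2) by simp
  ultimately obtain g :: "'g \<Rightarrow> real" where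
    g: "continuous_map euclidean (top_of_set {0..1}) g" "g 0 = 0" "g ` (- U) \<subseteq> {1}"
    unfolding completely_regular_space_def by meson
  have cont: "continuous_on UNIV g" and range: "\<And>t. g t \<in> {0..1}"
    using g(1) by (auto simp: continuous_map_in_subtopology)
  define h where "h t = 1 - g t" for t
  have h: "continuous_on UNIV h" "\<And>t. 0 \<le> h t" "\<And>t. t \<notin> U \<Longrightarrow> h t = 0" "h 0 = 1"
    using g cont range by (auto simp: h_def intro!: continuous_intros)
  have Cc: "(\<lambda>t. complex_of_real (c * h t)) \<in> Cc" for c
    by (rule CcI(1)[of _ L]) (use assms h in \<open>auto intro!: continuous_intros\<close>)
  have int: "integrable mG h"
    using integrable_Re[OF integrable_Cc[OF Cc[of 1]]] by simp
  have "0 < (LINT t|mG. h t)"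
  proof -
    have "(LINT t|mG. h t) \<noteq> 0"
    proof
      assume "(LINT t|mG. h t) = 0"
      then have "AE t in mG. h t = 0"
        using integral_nonneg_eq_0_iff_AE[OF int] h(2) by simp
      then have "emeasure mG {t. h t \<noteq> 0} = 0"
        by (subst (asm) AE_iff_measurable[OF _ refl])
          (use h(1) in \<open>auto intro!: borel_open open_Collect_neq continuous_intros\<close>)
      moreover have "open {t. h t \<noteq> 0}"
        using h(1) by (intro open_Collect_neq continuous_intros)
      ultimately show False
        using open_pos[of "{t. h t \<noteq> 0}"] h(4) by simp
    qed
    moreover have "0 \<le> (LINT t|mG. h t)"
      using h(2) by simp
    ultimately show ?thesis
      by simp
  qed
  then have "0 \<le> (1 / (LINT t|mG. h t)) * h t"
      "t \<notin> U \<Longrightarrow> (1 / (LINT t|mG. h t)) * h t = 0"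
      "(LINT t|mG. (1 / (LINT t|mG. h t)) * h t) = 1"
      "integrable mG (\<lambda>t. (1 / (LINT t|mG. h t)) * h t)" for t
    using h int by (auto intro!: divide_nonneg_pos)
  then show thesis
    using that[OF Cc[of "1 / (LINT t|mG. h t)"]] by blast
qed

section \<open>Convolution, and uniqueness of a Radon functional given on convolutions\<close>

lemma integrable_conv:
  assumes "\<phi> \<in> Cc" "\<psi> \<in> Cc"
  shows "integrable mG (\<lambda>s. \<phi> (t - s) * \<psi> s)"
proof -
  note [measurable] = assms[THEN borel_measurable_Cc]
  obtain K C where C: "\<And>t. norm (\<phi> t) \<le> C"
    using CcE[OF assms(1)] by metis
  show ?thesis
  proof (rule Bochner_Integration.integrable_bound)
    show "integrable mG (\<lambda>s. C * norm (\<psi> s))"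
      using integrable_Cc[OF assms(2)] by simp
    show "AE s in mG. norm (\<phi> (t - s) * \<psi> s) \<le> norm (C * norm (\<psi> s))"
      by (intro AE_I2) (auto simp: norm_mult abs_mult intro!: mult_right_mono order_trans[OF C])
  qed measurable
qed

lemma integrable_Cc_bounded:
  assumes "\<phi> \<in> Cc" "h \<in> borel_measurable borel" "\<And>t. norm (h t) \<le> C"
  shows "integrable mG (\<lambda>t. \<phi> t * h t)"
proof (rule Bochner_Integration.integrable_bound)
  show "integrable mG (\<lambda>t. C * norm (\<phi> t))"
    using integrable_Cc[OF assms(1)] by simp
  show "(\<lambda>t. \<phi> t * h t) \<in> borel_measurable mG"
    using assms(2) borel_measurable_Cc[OF assms(1)] by simp
  have "norm (\<phi> t * h t) \<le> C * norm (\<phi> t)" for t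
    using assms(3)[of t] by (simp add: norm_mult mult.commute[of C] mult_left_mono)
  then show "AE t in mG. norm (\<phi> t * h t) \<le> norm (C * norm (\<phi> t))"
    by (intro AE_I2) (metis abs_ge_self order_trans real_norm_def)
qed

lemma integrable_indicator_compact:
  assumes "compact B"
  shows "integrable mG (\<lambda>t. c * indicator B t :: real)"
  using emeasure_compact_finite[OF assms] compact_sets[OF assms]
  by (intro integrable_mult_right integrable_real_indicator) auto

lemma integrable_pair_compact:
  assumes "h \<in> borel_measurable (borel \<Otimes>\<^sub>M borel)" "compact A" "compact B"
    and "\<And>s t. norm (h (s, t)) \<le> D * indicator A s * indicator B t"
  shows "integrable (mG \<Otimes>\<^sub>M mG) (h :: _ \<Rightarrow> complex)"
proof (rule GG.integrable_product_bound[where a = "\<lambda>s. D * indicator A s" and b = "\<lambda>t. 1 * indicator B t"])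
  have "sets (mG \<Otimes>\<^sub>M mG) = sets (borel \<Otimes>\<^sub>M borel)"
    by (intro sets_pair_measure_cong sets_haar)
  then show "h \<in> borel_measurable (mG \<Otimes>\<^sub>M mG)"
    using assms(1) measurable_cong_sets by blast
  show "norm (h (s, t)) \<le> D * indicator A s * (1 * indicator B t)" for s t
    using assms(4) by simp
qed (intro integrable_indicator_compact assms)+

lemma conv_fun_eq_0:
  assumes "\<And>t. t \<notin> K \<Longrightarrow> \<phi> t = 0" "\<And>t. t \<notin> L \<Longrightarrow> \<psi> t = 0" "t \<notin> {k + l | k l. k \<in> K \<and> l \<in> L}"
  shows "conv_fun mG \<phi> \<psi> t = 0"
proof -
  have "\<phi> (t - s) * \<psi> s = 0" for s
  proof (cases "t - s \<in> K \<and> s \<in> L")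
    case True
    moreover have "t = (t - s) + s"
      by simp
    ultimately show ?thesis
      using assms(3) by blast
  next
    case False
    then show ?thesis
      using assms(1,2) by auto
  qed
  then show ?thesis
    unfolding conv_fun_def by (simp only: Bochner_Integration.integral_zero)
qed

text \<open>G is first countable, so sequences detect continuity, and dominated convergence applies
  with the majorant C |\<psi>|.\<close>

lemma conv_fun_continuous:
  assumes "\<phi> \<in> Cc" "\<psi> \<in> Cc"
  shows "continuous_on UNIV (conv_fun mG \<phi> \<psi>)"
proof -
  note [measurable] = assms[THEN borel_measurable_Cc]
  obtain K C where C: "\<And>t. norm (\<phi> t) \<le> C"
    using CcE[OF assms(1)] by metis
  have "(\<lambda>i. conv_fun mG \<phi> \<psi> (X i)) \<longlonglongrightarrow> conv_fun mG \<phi> \<psi> t" if X: "X \<longlonglongrightarrow> t" for X t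
    unfolding conv_fun_def
  proof (rule integral_dominated_convergence)
    show "integrable mG (\<lambda>s. C * norm (\<psi> s))"
      using integrable_Cc[OF assms(2)] by simp
    have "(\<lambda>i. \<phi> (X i - s)) \<longlonglongrightarrow> \<phi> (t - s)" for s
      using continuous_on_Cc[OF assms(1)] X
      by (intro isCont_tendsto_compose[of "t - s" \<phi>] tendsto_intros)
        (auto simp: continuous_on_eq_continuous_at)
    then show "AE s in mG. (\<lambda>i. \<phi> (X i - s) * \<psi> s) \<longlonglongrightarrow> \<phi> (t - s) * \<psi> s"
      by (intro AE_I2 tendsto_intros)
    show "AE s in mG. norm (\<phi> (X i - s) * \<psi> s) \<le> C * norm (\<psi> s)" for i
      using C by (intro AE_I2) (auto simp: norm_mult intro!: mult_right_mono)
  qed measurable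
  then show ?thesis
    by (simp add: continuous_on_def tendsto_at_iff_sequentially o_def)
qed

lemma conv_fun_Cc:
  assumes "\<phi> \<in> Cc" "\<psi> \<in> Cc"
  shows "conv_fun mG \<phi> \<psi> \<in> Cc"
proof -
  obtain K C where K: "compact K" "\<And>t. t \<notin> K \<Longrightarrow> \<phi> t = 0"
    using CcE[OF assms(1)] by metis
  obtain L D where L: "compact L" "\<And>t. t \<notin> L \<Longrightarrow> \<psi> t = 0"
    using CcE[OF assms(2)] by metis
  show ?thesis
    by (rule CcI(1)[OF conv_fun_continuous[OF assms] compact_sum_set[OF K(1) L(1)]])
      (rule conv_fun_eq_0[OF K(2) L(2)])
qed

text \<open>Approximate identity: \<open>\<phi>\<close> is a uniform limit of convolutions supported in one compact set.\<close>

lemma complex_radon_functional_eqI: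
  assumes \<gamma>: "complex_radon_functional \<gamma>" and \<gamma>': "complex_radon_functional \<gamma>'"
    and eq: "\<And>\<phi> \<psi>. \<phi> \<in> Cc \<Longrightarrow> \<psi> \<in> Cc \<Longrightarrow>
      \<gamma> (conv_fun mG \<phi> (tilde_fun \<psi>)) = \<gamma>' (conv_fun mG \<phi> (tilde_fun \<psi>))"
    and \<phi>: "\<phi> \<in> Cc"
  shows "\<gamma> \<phi> = \<gamma>' \<phi>"
proof -
  obtain K C where K: "compact K" "\<And>t. t \<notin> K \<Longrightarrow> \<phi> t = 0"
    using CcE[OF \<phi>] by metis
  obtain V L :: "'g set" where L: "open V" "compact L" "0 \<in> V" "V \<subseteq> L"
    using locally_compact unfolding locally_compact_space_def by simp metis
  \<comment> \<open>This compact set depends on \<phi> and L but not on \<epsilon>, so the bounds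
    \<open>C1\<close> and \<open>C2\<close> of the two functionals can be fixed before \<epsilon> is
    chosen.\<close>
  define S where "S = K \<union> {k + l | k l. k \<in> K \<and> l \<in> L}"
  have S: "compact S"
    unfolding S_def by (intro compact_Un K L compact_sum_set)
  obtain C1 where C1: "\<And>\<eta>. \<eta> \<in> Cc \<Longrightarrow> closure {t. \<eta> t \<noteq> 0} \<subseteq> S \<Longrightarrow> norm (\<gamma> \<eta>) \<le> C1 * (SUP t. norm (\<eta> t))"
    using \<gamma> S unfolding complex_radon_functional_def by metis
  obtain C2 where C2: "\<And>\<eta>. \<eta> \<in> Cc \<Longrightarrow> closure {t. \<eta> t \<noteq> 0} \<subseteq> S \<Longrightarrow> norm (\<gamma>' \<eta>) \<le> C2 * (SUP t. norm (\<eta> t))"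
    using \<gamma>' S unfolding complex_radon_functional_def by metis
  show ?thesis
  proof (rule complex_eq_if_norm_diff_le)
    fix \<epsilon> :: real assume \<epsilon>: "\<epsilon> > 0"
    obtain U where U: "open U" "0 \<in> U" "U \<subseteq> V" "\<And>v t. v \<in> U \<Longrightarrow> norm (\<phi> (t - v) - \<phi> t) < \<epsilon>"
      using Cc_uniformly_continuous[OF \<phi> \<epsilon> L] by metis
    then have "U \<subseteq> L"
      using L by simp
    then obtain \<psi> :: "'g \<Rightarrow> real" where \<psi>: "(\<lambda>t. complex_of_real (\<psi> t)) \<in> Cc"
      "\<And>t. 0 \<le> \<psi> t" "\<And>t. t \<notin> U \<Longrightarrow> \<psi> t = 0" "integrable mG \<psi>" "(LINT t|mG. \<psi> t) = 1"
      using bump_function[OF U(1,2) L(2)] by metis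
    let ?\<psi> = "\<lambda>t. complex_of_real (\<psi> t)"
    let ?c = "conv_fun mG \<phi> ?\<psi>"
    have c: "?c \<in> Cc"
      by (rule conv_fun_Cc[OF \<phi> \<psi>(1)])
    define \<eta> where "\<eta> t = ?c t - \<phi> t" for t
    have small: "norm (\<eta> t) \<le> \<epsilon>" for t
    proof -
      \<comment> \<open>Since \<psi> has integral 1, the value \<phi>(t) can be written as an
        integral against \<psi>; then \<eta>(t) averages \<phi>(t - s) - \<phi>(t) over s in
        U.\<close>
      have "\<eta> t = (LINT s|mG. \<phi> (t - s) * ?\<psi> s) - (LINT s|mG. \<phi> t * ?\<psi> s)"
        using \<psi>(4,5) by (simp add: \<eta>_def conv_fun_def)
      also have "\<dots> = (LINT s|mG. \<phi> (t - s) * ?\<psi> s - \<phi> t * ?\<psi> s)"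
        by (subst Bochner_Integration.integral_diff) (use integrable_conv[OF \<phi> \<psi>(1)] \<psi>(4) in auto)
      also have "norm \<dots> \<le> (LINT s|mG. \<epsilon> * \<psi> s)"
      proof (rule norm_integral_le)
        show "integrable mG (\<lambda>s. \<epsilon> * \<psi> s)"
          using \<psi>(4) by simp
        show "norm (\<phi> (t - s) * ?\<psi> s - \<phi> t * ?\<psi> s) \<le> \<epsilon> * \<psi> s" for s
        proof (cases "s \<in> U")
          case True
          have "norm (\<phi> (t - s) * ?\<psi> s - \<phi> t * ?\<psi> s) = norm (\<phi> (t - s) - \<phi> t) * \<psi> s"
            using \<psi>(2) by (simp flip: left_diff_distrib add: norm_mult)
          also have "\<dots> \<le> \<epsilon> * \<psi> s"
            using \<psi>(2) U(4)[OF True] by (intro mult_right_mono) (auto intro: less_imp_le)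
          finally show ?thesis .
        next
          case False
          then show ?thesis
            using \<psi>(3) by simp
        qed
      qed
      also have "\<dots> = \<epsilon>"
        using \<psi>(5) by simp
      finally show ?thesis .
    qed
    have cont: "continuous_on UNIV \<eta>"
      unfolding \<eta>_def using continuous_on_Cc[OF c] continuous_on_Cc[OF \<phi>] by (intro continuous_intros)
    have zero: "\<eta> t = 0" if "t \<notin> S" for t
    proof -
      have "?c t = 0"
        by (rule conv_fun_eq_0[of K _ L]) (use that K \<psi>(3) \<open>U \<subseteq> L\<close> in \<open>auto simp: S_def\<close>)
      then show ?thesis
        using that K by (simp add: \<eta>_def S_def)
    qed
    have \<eta>: "\<eta> \<in> Cc" "closure {t. \<eta> t \<noteq> 0} \<subseteq> S"
      using CcI[OF cont S] zero by blast+
    have sum: "?c = (\<lambda>t. \<phi> t + \<eta> t)"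
      by (simp add: \<eta>_def)
    have "\<gamma> ?c = \<gamma> \<phi> + \<gamma> \<eta>" "\<gamma>' ?c = \<gamma>' \<phi> + \<gamma>' \<eta>"
      using \<gamma>[unfolded complex_radon_functional_def, THEN conjunct1, rule_format, OF \<phi> \<eta>(1)]
        \<gamma>'[unfolded complex_radon_functional_def, THEN conjunct1, rule_format, OF \<phi> \<eta>(1)]
      by (simp_all only: sum)
    \<comment> \<open>Applying \<open>tilde_fun\<close> twice gives \<psi> back, so convolution with
      \<psi> has the form covered by \<open>eq\<close>.\<close>
    moreover have "\<gamma> ?c = \<gamma>' ?c"
      using eq[OF \<phi> tilde_fun_Cc[OF \<psi>(1)]] by (simp add: tilde_fun_def)
    ultimately have "\<gamma> \<phi> - \<gamma>' \<phi> = \<gamma>' \<eta> - \<gamma> \<eta>"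
      by (simp add: algebra_simps)
    then have "norm (\<gamma> \<phi> - \<gamma>' \<phi>) \<le> norm (\<gamma>' \<eta>) + norm (\<gamma> \<eta>)"
      by (metis norm_triangle_ineq4)
    \<comment> \<open>The constants \<open>C1\<close> and \<open>C2\<close> may be negative.
      Nonnegativity of the supremum permits passing to their absolute values.\<close>
    moreover have "0 \<le> (SUP t. norm (\<eta> t))"
      using small by (intro cSUP_upper2[of _ _ 0]) (auto intro!: bdd_aboveI)
    moreover have "(SUP t. norm (\<eta> t)) \<le> \<epsilon>"
      using small by (intro cSUP_least) auto
    ultimately have "C1 * (SUP t. norm (\<eta> t)) \<le> \<bar>C1\<bar> * \<epsilon>" "C2 * (SUP t. norm (\<eta> t)) \<le> \<bar>C2\<bar> * \<epsilon>"
      by (auto intro!: mult_mono)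
    then show "norm (\<gamma> \<phi> - \<gamma>' \<phi>) \<le> (\<bar>C1\<bar> + \<bar>C2\<bar>) * \<epsilon>"
      using C1[OF \<eta>] C2[OF \<eta>] \<open>norm (\<gamma> \<phi> - \<gamma>' \<phi>) \<le> norm (\<gamma>' \<eta>) + norm (\<gamma> \<eta>)\<close>
      by (simp add: algebra_simps)
  qed
qed

section \<open>Compactness of the van Hove boundary\<close>

text \<open>\<open>measure\<close> returns 0 on sets of infinite measure, so a bound by the measure
  of the boundary is meaningful only once that measure is known to be finite. Compactness provides
  this.\<close>

lemma compact_van_Hove_boundary:
  fixes B K :: "'g set"
  assumes "compact B" "compact K"
  shows "compact (van_Hove_boundary K B)"
proof -
  let ?S = "{b + k | b k. b \<in> B \<and> k \<in> K}"
  have S: "compact ?S"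
    by (rule compact_sum_set[OF assms])
  then have "closure (?S - B) \<subseteq> ?S"
    by (intro closure_minimal compact_imp_closed) auto
  then have "compact (closure (?S - B))"
    using S closed_Int_compact[of "closure (?S - B)" ?S] by (simp add: Int_absorb2)
  \<comment> \<open>The closure of the complement of B need not be compact, but c - k in B forces c
    into the compact set B + K.\<close>
  moreover have "{c - k | c k. c \<in> closure (UNIV - B) \<and> k \<in> K} \<inter> B
      = {c - k | c k. c \<in> closure (UNIV - B) \<inter> ?S \<and> k \<in> K} \<inter> B" (is "?l = ?r")
  proof (intro equalityI subsetI)
    fix x assume "x \<in> ?l"
    then obtain c k where x: "x = c - k" "c \<in> closure (UNIV - B)" "k \<in> K" "x \<in> B"
      by blast
    then have "c = x + k"
      by simp
    with x show "x \<in> ?r"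
      by blast
  qed auto
  moreover have "compact ?r"
    using S assms by (intro compact_Int compact_diff_set closed_Int_compact) auto
  ultimately show ?thesis
    unfolding van_Hove_boundary_def by (simp only: compact_Un)
qed

end

section \<open>The dynamical system and the functions along its orbits\<close>

locale haar_system = haar_group mG
  for mG :: "'g::{topological_ab_group_add, t2_space, second_countable_topology} measure" +
  fixes \<alpha> :: "'g \<Rightarrow> 'x::t2_space \<Rightarrow> 'x" and m :: "'x measure" and f :: "'x \<Rightarrow> complex"
  assumes system: "dynamical_system \<alpha> m" and continuous_f: "continuous_on UNIV f"
begin

abbreviation orb :: "'g \<Rightarrow> 'x \<Rightarrow> complex" where "orb t x \<equiv> koopman \<alpha> t f x"

sublocale m: prob_space m
  using system by (simp add: dynamical_system_def)

sublocale Gm: pair_sigma_finite mG m ..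

lemma sets_m [measurable_cong, simp]: "sets m = sets borel"
  using system by (simp add: dynamical_system_def radon_measure_def)

lemma space_m [simp]: "space m = UNIV"
  using sets_eq_imp_space_eq[OF sets_m] by simp

lemma action_add: "\<alpha> (s + t) x = \<alpha> s (\<alpha> t x)"
  using system by (simp add: dynamical_system_def)

lemma action_0 [simp]: "\<alpha> 0 x = x"
  using system by (simp add: dynamical_system_def)

lemma continuous_action: "continuous_on UNIV (\<lambda>p. \<alpha> (fst p) (snd p))"
  using system by (simp add: dynamical_system_def case_prod_unfold)

lemma measurable_f [measurable]: "f \<in> borel_measurable borel"
  using continuous_f by (rule borel_measurable_continuous_onI)

text \<open>The map (t, x) \<mapsto> f(\<alpha>(-t) x) is continuous on G x X, and the countable
  base of G alone makes it measurable for the product sigma-algebra. Composing with arbitrary g and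
  k gives a rule that applies inside double integrals.\<close>

lemma measurable_orb [measurable (raw)]:
  assumes "g \<in> borel_measurable N" "k \<in> borel_measurable N"
  shows "(\<lambda>z. orb (g z) (k z)) \<in> borel_measurable N"
proof -
  have "continuous_on UNIV (\<lambda>p. f (\<alpha> (- fst p) (snd p)))"
    using continuous_on_compose2[OF continuous_action, of UNIV "\<lambda>p. (- fst p, snd p)"]
      continuous_on_compose2[OF continuous_f, of UNIV "\<lambda>p. \<alpha> (- fst p) (snd p)"]
    by (simp add: continuous_on_Pair continuous_on_minus continuous_on_fst continuous_on_snd continuous_on_id)
  then have "(\<lambda>p. f (\<alpha> (- fst p) (snd p))) \<in> borel_measurable (borel \<Otimes>\<^sub>M borel)"
    by (rule borel_measurable_pair_continuous)
  from measurable_compose[OF measurable_Pair[OF assms] this] show ?thesis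
    by (simp add: koopman_def)
qed

lemma orb_bounded: obtains M where "0 \<le> M" "\<And>x. norm (f x) \<le> M" "\<And>t x. norm (orb t x) \<le> M"
proof -
  have "compact (range f)"
    using system continuous_f by (intro compact_continuous_image) (auto simp: dynamical_system_def)
  then obtain M where M: "\<And>x. norm (f x) \<le> M"
    by (metis bounded_iff compact_imp_bounded rangeI)
  then have "0 \<le> M"
    using order_trans[OF norm_ge_zero M] by simp
  then show thesis
    using M by (intro that[of M]) (auto simp: koopman_def)
qed

text \<open>Commutativity of G enters through -(s + t) = -s + (-t).\<close>

lemma orb_add: "orb (s + t) x = orb s (\<alpha> (- t) x)"
  by (simp add: koopman_def flip: action_add)

lemma continuous_action_fixed: "continuous_on UNIV (\<alpha> t)"
  using continuous_on_compose2[OF continuous_action, of UNIV "\<lambda>x. (t, x)"]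
  by (simp add: continuous_on_Pair continuous_on_id)

lemma measurable_action_fixed [measurable]: "\<alpha> t \<in> borel_measurable borel"
  by (intro borel_measurable_continuous_onI continuous_action_fixed)

lemma distr_action: "distr m borel (\<alpha> t) = m"
proof (rule measure_eqI)
  fix A assume "A \<in> sets (distr m borel (\<alpha> t))"
  then have A: "A \<in> sets borel"
    by simp
  have "\<alpha> t -` A = \<alpha> (- t) ` A"
  proof (intro equalityI subsetI)
    fix x assume "x \<in> \<alpha> t -` A"
    then show "x \<in> \<alpha> (- t) ` A"
      by (intro image_eqI[of _ _ "\<alpha> t x"]) (simp_all flip: action_add)
  qed (auto simp flip: action_add)
  moreover have "emeasure m (\<alpha> (- t) ` A) = emeasure m A"
    using system A by (simp add: dynamical_system_def)
  ultimately show "emeasure (distr m borel (\<alpha> t)) A = emeasure m A"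
    using A by (subst emeasure_distr) auto
qed simp

section \<open>The correlation function as density of the autocorrelation\<close>

definition corr :: "'g \<Rightarrow> complex" where
  "corr u = (LINT x|m. orb u x * cnj (f x))"

lemma measurable_corr [measurable]: "corr \<in> borel_measurable borel"
  unfolding corr_def by measurable

text \<open>Both factors are functions of \<alpha>(-s) x, and m is invariant under \<alpha>(-s), so
  the inner product of T_t f and T_s f depends only on t - s.\<close>

lemma corr_diff: "(LINT x|m. orb t x * cnj (orb s x)) = corr (t - s)"
proof -
  have "orb t x * cnj (orb s x) = orb (t - s) (\<alpha> (- s) x) * cnj (f (\<alpha> (- s) x))" for x
    using orb_add[of "t - s" s x] by (simp add: koopman_def)
  then show ?thesis
    using integral_distr[of "\<alpha> (- s)" m borel "\<lambda>x. orb (t - s) x * cnj (f x)"]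
    by (simp add: corr_def distr_action)
qed

lemma norm_corr_le:
  assumes "\<And>x. norm (f x) \<le> M" "\<And>t x. norm (orb t x) \<le> M"
  shows "norm (corr u) \<le> M * M"
proof -
  have "norm (corr u) \<le> (LINT x|m. M * M)"
    unfolding corr_def
    by (rule norm_integral_le) (use assms order_trans[OF norm_ge_zero assms(1)] in \<open>auto simp: norm_mult intro!: mult_mono\<close>)
  then show ?thesis
    by (simp add: m.prob_space[simplified])
qed

text \<open>The density is bounded by M * M, so M * M times the Haar measure of K is a bound on
  functions supported in K. The \<open>restrict\<close> matches the extensionality required in the
  definition of \<open>autocorrelation\<close>.\<close>

lemma radon_functional_corr:
  "complex_radon_functional (restrict (\<lambda>\<phi>. LINT u|mG. \<phi> u * corr u) Cc)"
proof -
  obtain M where M: "0 \<le> M" "\<And>x. norm (f x) \<le> M" "\<And>t x. norm (orb t x) \<le> M"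
    using orb_bounded by metis
  note int = integrable_Cc_bounded[OF _ measurable_corr norm_corr_le[OF M(2,3)]]
  have add: "(\<lambda>t. \<phi> t + \<psi> t) \<in> Cc" and scale: "(\<lambda>t. c * \<phi> t) \<in> Cc"
    if \<phi>: "\<phi> \<in> Cc" and \<psi>: "\<psi> \<in> Cc" for \<phi> \<psi> :: "'g \<Rightarrow> complex" and c
  proof -
    obtain K C where K: "compact K" "\<And>t. t \<notin> K \<Longrightarrow> \<phi> t = 0"
      using CcE[OF \<phi>] by metis
    obtain L D where L: "compact L" "\<And>t. t \<notin> L \<Longrightarrow> \<psi> t = 0"
      using CcE[OF \<psi>] by metis
    show "(\<lambda>t. \<phi> t + \<psi> t) \<in> Cc"
      using K L \<phi> \<psi> by (intro CcI(1)[of _ "K \<union> L"]) (auto intro: continuous_on_add continuous_on_Cc)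
    show "(\<lambda>t. c * \<phi> t) \<in> Cc"
      using K \<phi> by (intro CcI(1)[of _ K]) (auto intro: continuous_on_mult_left continuous_on_Cc)
  qed
  show ?thesis
    unfolding complex_radon_functional_def
  proof (intro conjI ballI allI impI)
    fix \<phi> \<psi> :: "'g \<Rightarrow> complex" assume "\<phi> \<in> Cc" "\<psi> \<in> Cc"
    then show "restrict (\<lambda>\<phi>. LINT u|mG. \<phi> u * corr u) Cc (\<lambda>t. \<phi> t + \<psi> t)
        = restrict (\<lambda>\<phi>. LINT u|mG. \<phi> u * corr u) Cc \<phi> + restrict (\<lambda>\<phi>. LINT u|mG. \<phi> u * corr u) Cc \<psi>"
      using int add by (simp add: distrib_right)
  next
    fix c and \<phi> :: "'g \<Rightarrow> complex" assume "\<phi> \<in> Cc"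
    then show "restrict (\<lambda>\<phi>. LINT u|mG. \<phi> u * corr u) Cc (\<lambda>t. c * \<phi> t)
        = c * restrict (\<lambda>\<phi>. LINT u|mG. \<phi> u * corr u) Cc \<phi>"
      using scale by (simp add: mult.assoc)
  next
    fix K :: "'g set" assume K: "compact K"
    then have [measurable]: "K \<in> sets borel"
      by (rule compact_sets)
    show "\<exists>C. \<forall>\<phi>\<in>Cc. closure {t. \<phi> t \<noteq> 0} \<subseteq> K \<longrightarrow>
        norm (restrict (\<lambda>\<phi>. LINT u|mG. \<phi> u * corr u) Cc \<phi>) \<le> C * (SUP t. norm (\<phi> t))"
    proof (intro exI ballI impI)
      fix \<phi> :: "'g \<Rightarrow> complex" assume \<phi>: "\<phi> \<in> Cc" and sub: "closure {t. \<phi> t \<noteq> 0} \<subseteq> K"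
      obtain C where C: "\<And>t. norm (\<phi> t) \<le> C"
        using CcE[OF \<phi>] by metis
      let ?S = "SUP t. norm (\<phi> t)"
      have S: "norm (\<phi> t) \<le> ?S" for t
        using C by (intro cSUP_upper) (auto intro!: bdd_aboveI)
      have zero: "\<phi> t = 0" if "t \<notin> K" for t
        using that sub closure_subset[of "{t. \<phi> t \<noteq> 0}"] by auto
      have "norm (LINT u|mG. \<phi> u * corr u) \<le> (LINT u|mG. (?S * (M * M)) * indicator K u)"
      proof (rule norm_integral_le)
        show "integrable mG (\<lambda>u. (?S * (M * M)) * indicator K u :: real)"
          using emeasure_compact_finite[OF K] by (intro integrable_mult_right integrable_real_indicator) auto
        show "norm (\<phi> u * corr u) \<le> (?S * (M * M)) * indicator K u" for u
          using zero[of u] S[of u] norm_corr_le[OF M(2,3)] order_trans[OF norm_ge_zero S]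
          by (auto simp: norm_mult indicator_def intro!: mult_mono)
      qed
      also have "\<dots> = (M * M * measure mG K) * ?S"
        by simp
      finally show "norm (restrict (\<lambda>\<phi>. LINT u|mG. \<phi> u * corr u) Cc \<phi>) \<le> (M * M * measure mG K) * ?S"
        using \<phi> by simp
    qed
  qed
qed

text \<open>Fubini on G x X is used twice: first with the smear of \<psi> kept as one bounded
  function \<open>S\<close>, then inside \<open>S\<close>. Constants are integrable over the
  probability measure m, so |\<phi>| and |\<psi>| supply the majorants. The remaining integral over
  X is evaluated by \<open>corr_diff\<close>.\<close>

lemma smear_inner:
  assumes \<phi>: "\<phi> \<in> Cc" and \<psi>: "\<psi> \<in> Cc"
  shows "L2_inner m (smear mG \<alpha> f \<phi>) (smear mG \<alpha> f \<psi>)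
    = (LINT t|mG. \<phi> t * (LINT s|mG. cnj (\<psi> s) * corr (t - s)))"
proof -
  note [measurable] = \<phi>[THEN borel_measurable_Cc] \<psi>[THEN borel_measurable_Cc]
  obtain M where M: "0 \<le> M" "\<And>x. norm (f x) \<le> M" "\<And>t x. norm (orb t x) \<le> M"
    using orb_bounded by metis
  define S where "S x = (LINT s|mG. \<psi> s * orb s x)" for x
  have [measurable]: "S \<in> borel_measurable borel"
    unfolding S_def by measurable
  define N where "N = (LINT s|mG. norm (\<psi> s) * M)"
  have S_le: "norm (S x) \<le> N" for x
    unfolding S_def N_def
    by (rule norm_integral_le) (use integrable_Cc[OF \<psi>] M in \<open>auto simp: norm_mult intro!: mult_left_mono\<close>)
  have "L2_inner m (smear mG \<alpha> f \<phi>) (smear mG \<alpha> f \<psi>)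
      = (LINT x|m. (LINT t|mG. \<phi> t * orb t x * cnj (S x)))"
    by (simp add: L2_inner_def smear_def S_def)
  also have "\<dots> = (LINT t|mG. (LINT x|m. \<phi> t * orb t x * cnj (S x)))"
  proof (rule Gm.Fubini_integral)
    show "integrable (mG \<Otimes>\<^sub>M m) (\<lambda>(t, x). \<phi> t * orb t x * cnj (S x))"
    proof (rule Gm.integrable_product_bound[where a = "\<lambda>t. norm (\<phi> t)" and b = "\<lambda>_. M * N"])
      show "norm (case (t, x) of (t, x) \<Rightarrow> \<phi> t * orb t x * cnj (S x)) \<le> norm (\<phi> t) * (M * N)" for t x
        using M S_le[of x] by (auto simp: norm_mult mult.assoc intro!: mult_left_mono mult_mono)
    qed (use integrable_Cc[OF \<phi>] in auto)
  qed
  also have "\<dots> = (LINT t|mG. \<phi> t * (LINT s|mG. cnj (\<psi> s) * corr (t - s)))"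
  proof (rule Bochner_Integration.integral_cong[OF refl])
    fix t
    have "(LINT x|m. \<phi> t * orb t x * cnj (S x)) = \<phi> t * (LINT x|m. orb t x * cnj (S x))"
      by (simp add: mult.assoc)
    also have "(LINT x|m. orb t x * cnj (S x)) = (LINT x|m. (LINT s|mG. cnj (\<psi> s) * (orb t x * cnj (orb s x))))"
    proof (rule Bochner_Integration.integral_cong[OF refl])
      fix x
      have "cnj (S x) = (LINT s|mG. cnj (\<psi> s) * cnj (orb s x))"
        using Bochner_Integration.integral_cnj[of mG "\<lambda>s. \<psi> s * orb s x"] by (simp add: S_def)
      then have "orb t x * cnj (S x) = (LINT s|mG. orb t x * (cnj (\<psi> s) * cnj (orb s x)))"
        by simp
      then show "orb t x * cnj (S x) = (LINT s|mG. cnj (\<psi> s) * (orb t x * cnj (orb s x)))"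
        by (simp add: mult.left_commute)
    qed
    also have "\<dots> = (LINT s|mG. (LINT x|m. cnj (\<psi> s) * (orb t x * cnj (orb s x))))"
    proof (rule Gm.Fubini_integral)
      show "integrable (mG \<Otimes>\<^sub>M m) (\<lambda>(s, x). cnj (\<psi> s) * (orb t x * cnj (orb s x)))"
      proof (rule Gm.integrable_product_bound[where a = "\<lambda>s. norm (\<psi> s)" and b = "\<lambda>_. M * M"])
        show "norm (case (s, x) of (s, x) \<Rightarrow> cnj (\<psi> s) * (orb t x * cnj (orb s x))) \<le> norm (\<psi> s) * (M * M)" for s x
          using M by (auto simp: norm_mult mult.assoc intro!: mult_left_mono mult_mono)
      qed (use integrable_Cc[OF \<psi>] in auto)
    qed
    also have "\<dots> = (LINT s|mG. cnj (\<psi> s) * corr (t - s))"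
      by (simp add: corr_diff)
    finally show "(LINT x|m. \<phi> t * orb t x * cnj (S x)) = \<phi> t * (LINT s|mG. cnj (\<psi> s) * corr (t - s))" .
  qed
  finally show ?thesis .
qed

text \<open>After s is replaced by -s, the convolution at r integrates \<phi>(r + s) cnj(\<psi>(s)).
  Exchanging the integrals, substituting t = r + s and exchanging back produces the right-hand side
  of \<open>smear_inner\<close>.\<close>

lemma integral_conv_corr:
  assumes \<phi>: "\<phi> \<in> Cc" and \<psi>: "\<psi> \<in> Cc"
  shows "(LINT r|mG. conv_fun mG \<phi> (tilde_fun \<psi>) r * corr r)
    = (LINT t|mG. \<phi> t * (LINT s|mG. cnj (\<psi> s) * corr (t - s)))"
proof -
  note [measurable] = \<phi>[THEN borel_measurable_Cc] \<psi>[THEN borel_measurable_Cc]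
  obtain M where M: "0 \<le> M" "\<And>x. norm (f x) \<le> M" "\<And>t x. norm (orb t x) \<le> M"
    using orb_bounded by metis
  note corr_le = norm_corr_le[OF M(2,3)]
  obtain K C where K: "compact K" "\<And>t. t \<notin> K \<Longrightarrow> \<phi> t = 0" "0 \<le> C" "\<And>t. norm (\<phi> t) \<le> C"
    using CcE[OF \<phi>] by metis
  obtain L D where L: "compact L" "\<And>t. t \<notin> L \<Longrightarrow> \<psi> t = 0"
    using CcE[OF \<psi>] by metis
  \<comment> \<open>\<open>corr\<close> itself need not be integrable. In the first exchange r + s
    in K and s in L force r into K - L, which gives a majorant with compact support in r.\<close>
  let ?S = "{k - l | k l. k \<in> K \<and> l \<in> L}"
  have S: "compact ?S"
    using K L by (intro compact_diff_set)
  then have [measurable]: "?S \<in> sets borel"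
    by (rule compact_sets)
  have "conv_fun mG \<phi> (tilde_fun \<psi>) r = (LINT s|mG. \<phi> (r + s) * cnj (\<psi> s))" for r
    using integral_inversion[of "\<lambda>s. \<phi> (r + s) * cnj (\<psi> s)"] by (simp add: conv_fun_def tilde_fun_def)
  then have "(LINT r|mG. conv_fun mG \<phi> (tilde_fun \<psi>) r * corr r)
      = (LINT r|mG. (LINT s|mG. \<phi> (r + s) * cnj (\<psi> s) * corr r))"
    by simp
  also have "\<dots> = (LINT s|mG. (LINT r|mG. \<phi> (r + s) * cnj (\<psi> s) * corr r))"
  proof (rule GG.Fubini_integral)
    show "integrable (mG \<Otimes>\<^sub>M mG) (\<lambda>(s, r). \<phi> (r + s) * cnj (\<psi> s) * corr r)"
    proof (rule GG.integrable_product_bound[where a = "\<lambda>s. norm (\<psi> s)" and b = "\<lambda>r. C * (M * M) * indicator ?S r"])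
      show "norm (case (s, r) of (s, r) \<Rightarrow> \<phi> (r + s) * cnj (\<psi> s) * corr r)
          \<le> norm (\<psi> s) * (C * (M * M) * indicator ?S r)" for s r
      proof (cases "r + s \<in> K \<and> s \<in> L")
        case True
        moreover have "r = (r + s) - s"
          by simp
        ultimately have "r \<in> ?S"
          by blast
        moreover have "norm (\<psi> s) * (norm (\<phi> (r + s)) * norm (corr r)) \<le> norm (\<psi> s) * (C * (M * M))"
          using K corr_le by (intro mult_left_mono mult_mono) auto
        ultimately show ?thesis
          by (simp add: norm_mult ac_simps)
      next
        case False
        then show ?thesis
          using K L M by auto
      qed
      show "integrable mG (\<lambda>r. C * (M * M) * indicator ?S r :: real)"
        using emeasure_compact_finite[OF S] by (intro integrable_mult_right integrable_real_indicator) auto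
    qed (use integrable_Cc[OF \<psi>] in auto)
  qed
  also have "\<dots> = (LINT s|mG. (LINT t|mG. \<phi> t * cnj (\<psi> s) * corr (t - s)))"
  proof (rule Bochner_Integration.integral_cong[OF refl])
    fix s
    show "(LINT r|mG. \<phi> (r + s) * cnj (\<psi> s) * corr r) = (LINT t|mG. \<phi> t * cnj (\<psi> s) * corr (t - s))"
      using integral_translation[of "\<lambda>t. \<phi> t * cnj (\<psi> s) * corr (t - s)" s] by (simp add: add.commute)
  qed
  also have "\<dots> = (LINT t|mG. (LINT s|mG. \<phi> t * cnj (\<psi> s) * corr (t - s)))"
  proof (rule GG.Fubini_integral)
    show "integrable (mG \<Otimes>\<^sub>M mG) (\<lambda>(t, s). \<phi> t * cnj (\<psi> s) * corr (t - s))"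
    proof (rule GG.integrable_product_bound[where a = "\<lambda>t. norm (\<phi> t)" and b = "\<lambda>s. norm (\<psi> s) * (M * M)"])
      show "norm (case (t, s) of (t, s) \<Rightarrow> \<phi> t * cnj (\<psi> s) * corr (t - s)) \<le> norm (\<phi> t) * (norm (\<psi> s) * (M * M))" for t s
        using corr_le by (auto simp: norm_mult mult.assoc intro!: mult_left_mono)
    qed (use integrable_Cc[OF \<phi>] integrable_Cc[OF \<psi>] in auto)
  qed
  finally show ?thesis
    by (simp add: mult.assoc)
qed

text \<open>The two preceding lemmas verify the defining identity,
  \<open>complex_radon_functional_eqI\<close> forces agreement on \<open>Cc\<close>, and
  extensionality fixes the values elsewhere. This resolves the \<open>THE\<close>.\<close>

lemma autocorrelation_eq:
  assumes "\<phi> \<in> Cc"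
  shows "autocorrelation mG \<alpha> m f \<phi> = (LINT u|mG. \<phi> u * corr u)"
proof -
  have "autocorrelation mG \<alpha> m f = restrict (\<lambda>\<phi>. LINT u|mG. \<phi> u * corr u) Cc" (is "_ = ?\<gamma>")
    unfolding autocorrelation_def
  proof (rule the_equality)
    have product: "?\<gamma> (conv_fun mG \<phi> (tilde_fun \<psi>)) = L2_inner m (smear mG \<alpha> f \<phi>) (smear mG \<alpha> f \<psi>)"
      if "\<phi> \<in> Cc" "\<psi> \<in> Cc" for \<phi> \<psi>
      using that by (simp add: conv_fun_Cc tilde_fun_Cc integral_conv_corr smear_inner)
    then show "?\<gamma> \<in> extensional Cc \<and> complex_radon_functional ?\<gamma> \<and>
        (\<forall>\<phi>\<in>Cc. \<forall>\<psi>\<in>Cc. ?\<gamma> (conv_fun mG \<phi> (tilde_fun \<psi>)) = L2_inner m (smear mG \<alpha> f \<phi>) (smear mG \<alpha> f \<psi>))"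
      using radon_functional_corr restrict_extensional by blast
    fix \<gamma> assume \<gamma>: "\<gamma> \<in> extensional Cc \<and> complex_radon_functional \<gamma> \<and>
        (\<forall>\<phi>\<in>Cc. \<forall>\<psi>\<in>Cc. \<gamma> (conv_fun mG \<phi> (tilde_fun \<psi>)) = L2_inner m (smear mG \<alpha> f \<phi>) (smear mG \<alpha> f \<psi>))"
    show "\<gamma> = ?\<gamma>"
    proof (rule extensionalityI)
      show "\<gamma> \<in> extensional Cc" "?\<gamma> \<in> extensional Cc"
        using \<gamma> by auto
      show "\<gamma> \<phi> = ?\<gamma> \<phi>" if "\<phi> \<in> Cc" for \<phi>
        by (rule complex_radon_functional_eqI[OF _ radon_functional_corr _ that])
          (use \<gamma> product in auto)
    qed
  qed
  with assms show ?thesis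
    by simp
qed

section \<open>Orbit averages and their almost sure convergence\<close>

text \<open>This is A_n(u, x) of the overview for B = B_n: by \<open>orb_add\<close> the integrand
  is the product of T_u f and cnj f at \<alpha>(-t) x. The scalar indicator is what the set integral
  in \<open>birkhoff_along\<close> unfolds to.\<close>

definition orbit_average :: "'g set \<Rightarrow> 'g \<Rightarrow> 'x \<Rightarrow> complex" where
  "orbit_average B u x =
     complex_of_real (1 / measure mG B) * (LINT t|mG. indicator B t *\<^sub>R (orb (u + t) x * cnj (orb t x)))"

lemma measurable_orbit_average [measurable (raw)]:
  assumes [measurable]: "B \<in> sets borel" "g \<in> borel_measurable N" "k \<in> borel_measurable N"
  shows "(\<lambda>z. orbit_average B (g z) (k z)) \<in> borel_measurable N"
  unfolding orbit_average_def by measurable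

lemma norm_orbit_average_le:
  assumes B: "compact B" "measure mG B > 0"
    and M: "0 \<le> M" "\<And>t x. norm (orb t x) \<le> M"
  shows "norm (orbit_average B u x) \<le> M * M"
proof -
  have "norm (LINT t|mG. indicator B t *\<^sub>R (orb (u + t) x * cnj (orb t x))) \<le> (LINT t|mG. (M * M) * indicator B t)"
    by (rule norm_integral_le[OF integrable_indicator_compact[OF B(1)]])
      (use M in \<open>auto simp: norm_mult indicator_def intro!: mult_mono\<close>)
  also have "\<dots> = M * M * measure mG B"
    by simp
  finally show ?thesis
    using B(2) by (simp add: orbit_average_def norm_mult norm_divide field_simps)
qed

lemma AE_orbit_average_tendsto:
  assumes birk: "birkhoff_along mG \<alpha> m B" and B: "\<And>n. compact (B n)"
  shows "AE x in m. AE u in mG. (\<lambda>n. orbit_average (B n) u x) \<longlonglongrightarrow> corr u"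
proof -
  have [measurable]: "B n \<in> sets borel" for n
    using B by (rule compact_sets)
  obtain M where M: "0 \<le> M" "\<And>x. norm (f x) \<le> M" "\<And>t x. norm (orb t x) \<le> M"
    using orb_bounded by metis
  \<comment> \<open>Convergence to a limit that varies with u is restated as convergence of real
    numbers to 0, the form in which the set of convergence is shown to be measurable.\<close>
  have norm_iff: "X \<longlonglongrightarrow> l \<longleftrightarrow> (\<lambda>n. norm (X n - l)) \<longlonglongrightarrow> 0" for X :: "nat \<Rightarrow> complex" and l
    by (simp add: tendsto_norm_zero_iff LIM_zero_iff)
  have "AE x in m. (\<lambda>n. orbit_average (B n) u x) \<longlonglongrightarrow> corr u" for u
  proof -
    have "integrable m (\<lambda>x. orb u x * cnj (f x))"
    proof (rule m.integrable_const_bound[of _ "M * M"])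
      show "AE x in m. norm (orb u x * cnj (f x)) \<le> M * M"
        using M by (auto simp: norm_mult intro!: mult_mono)
    qed measurable
    then have "AE x in m. (\<lambda>n. complex_of_real (1 / measure mG (B n)) *
        (LINT t:B n|mG. orb u (\<alpha> (- t) x) * cnj (f (\<alpha> (- t) x)))) \<longlonglongrightarrow> corr u"
      using birk unfolding birkhoff_along_def corr_def by blast
    moreover have "orbit_average (B n) u x = complex_of_real (1 / measure mG (B n)) *
        (LINT t:B n|mG. orb u (\<alpha> (- t) x) * cnj (f (\<alpha> (- t) x)))" for n x
      unfolding orbit_average_def set_lebesgue_integral_def orb_add by (simp add: koopman_def)
    ultimately show ?thesis
      by simp
  qed
  then have "AE u in mG. AE x in m. (\<lambda>n. orbit_average (B n) u x) \<longlonglongrightarrow> corr u"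
    by simp
  then have "AE u in mG. AE x in m. (\<lambda>n. norm (orbit_average (B n) u x - corr u)) \<longlonglongrightarrow> 0"
    by (simp only: norm_iff)
  \<comment> \<open>The null set supplied by Birkhoff's theorem depends on u. Joint measurability of
    the convergence set is what permits exchanging the two quantifiers.\<close>
  moreover have "{p \<in> space (mG \<Otimes>\<^sub>M m). (\<lambda>n. norm (orbit_average (B n) (fst p) (snd p) - corr (fst p))) \<longlonglongrightarrow> 0}
      \<in> sets (mG \<Otimes>\<^sub>M m)"
    by measurable
  ultimately have "AE x in m. AE u in mG. (\<lambda>n. norm (orbit_average (B n) u x - corr u)) \<longlonglongrightarrow> 0"
    using Gm.AE_commute[of "\<lambda>u x. (\<lambda>n. norm (orbit_average (B n) u x - corr u)) \<longlonglongrightarrow> 0"] by blast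
  then show ?thesis
    by (simp only: norm_iff)
qed

lemma orbit_average_dominated:
  assumes \<phi>: "\<phi> \<in> Cc" and B: "\<And>n. compact (B n)" "\<And>n. measure mG (B n) > 0"
    and lim: "AE u in mG. (\<lambda>n. orbit_average (B n) u x) \<longlonglongrightarrow> corr u"
  shows "(\<lambda>n. LINT u|mG. \<phi> u * orbit_average (B n) u x) \<longlonglongrightarrow> (LINT u|mG. \<phi> u * corr u)"
proof -
  note [measurable] = borel_measurable_Cc[OF \<phi>] compact_sets[OF B(1)]
  obtain M where M: "0 \<le> M" "\<And>x. norm (f x) \<le> M" "\<And>t x. norm (orb t x) \<le> M"
    using orb_bounded by metis
  show ?thesis
  proof (rule integral_dominated_convergence)
    show "integrable mG (\<lambda>u. norm (\<phi> u) * (M * M))"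
      using integrable_Cc[OF \<phi>] by simp
    show "AE u in mG. (\<lambda>n. \<phi> u * orbit_average (B n) u x) \<longlonglongrightarrow> \<phi> u * corr u"
      using lim by eventually_elim (intro tendsto_intros)
    show "AE u in mG. norm (\<phi> u * orbit_average (B n) u x) \<le> norm (\<phi> u) * (M * M)" for n
      using norm_orbit_average_le[OF B M(1,3)] by (auto simp: norm_mult intro!: mult_left_mono)
  qed measurable
qed

section \<open>Comparing the empirical autocorrelation with orbit averages\<close>

lemma empirical_autocorrelation_eq:
  "empirical_autocorrelation mG \<alpha> f x B \<phi> = complex_of_real (1 / measure mG B) *
     (LINT s|mG. (LINT t|mG. indicator B s * indicator B t * \<phi> (s - t) * cnj (orb t x) * orb s x))"
proof -
  \<comment> \<open>The two conjugations cancel on g and leave the conjugate density together with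
    the reflection, which later turns \<phi>(s + t) into \<phi>(s - t).\<close>
  have "tilde_functional (restrict_functional (orbit_measure mG \<alpha> f x) B) g
      = (LINT t|mG. indicator B t * g (- t) * cnj (orb t x))" for g
  proof -
    have "cnj (LINT t|mG. indicator B t * cnj (g (- t)) * orb t x)
        = (LINT t|mG. cnj (indicator B t * cnj (g (- t)) * orb t x))"
      by (rule Bochner_Integration.integral_cnj[symmetric])
    also have "\<dots> = (LINT t|mG. indicator B t * g (- t) * cnj (orb t x))"
      by (intro Bochner_Integration.integral_cong) (auto simp: indicator_def)
    finally show ?thesis
      by (simp add: tilde_functional_def restrict_functional_def orbit_measure_def density_functional_def
          tilde_fun_def koopman_def)
  qed
  moreover have "restrict_functional (orbit_measure mG \<alpha> f x) B g = (LINT s|mG. indicator B s * g s * orb s x)" for g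
    by (simp add: restrict_functional_def orbit_measure_def density_functional_def koopman_def)
  ultimately have "empirical_autocorrelation mG \<alpha> f x B \<phi> = complex_of_real (1 / measure mG B) *
     (LINT s|mG. indicator B s * (LINT t|mG. indicator B t * \<phi> (s - t) * cnj (orb t x)) * orb s x)"
    by (simp add: empirical_autocorrelation_def conv_functional_def Let_def)
  also have "(LINT s|mG. indicator B s * (LINT t|mG. indicator B t * \<phi> (s - t) * cnj (orb t x)) * orb s x)
     = (LINT s|mG. (LINT t|mG. indicator B s * (indicator B t * \<phi> (s - t) * cnj (orb t x)) * orb s x))"
    by simp
  finally show ?thesis
    by (simp only: mult.assoc)
qed

text \<open>Both terms are double integrals of the same integrand, with s ranging over G in one and
  over B in the other. The integrand vanishes unless s lies in B + K, so they differ only through s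
  in (B + K) - B, a part of the boundary. There the inner integral is at most M * M times the L1
  norm of \<phi>.\<close>

lemma empirical_autocorrelation_approx:
  assumes \<phi>: "\<phi> \<in> Cc" and K: "compact K" "\<And>t. t \<notin> K \<Longrightarrow> \<phi> t = 0"
    and B: "compact B"
    and M: "0 \<le> M" "\<And>t x. norm (orb t x) \<le> M"
  shows "norm ((LINT u|mG. \<phi> u * orbit_average B u x) - empirical_autocorrelation mG \<alpha> f x B \<phi>)
    \<le> M * M * (LINT u|mG. norm (\<phi> u)) * (measure mG (van_Hove_boundary K B) / measure mG B)"
proof -
  note [measurable] = borel_measurable_Cc[OF \<phi>] compact_sets[OF B]
  obtain K' C where C: "0 \<le> C" "\<And>t. norm (\<phi> t) \<le> C"
    using CcE[OF \<phi>] by metis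
  let ?V = "van_Hove_boundary K B"
  have V: "compact ?V"
    by (rule compact_van_Hove_boundary[OF B K(1)])
  let ?S = "{b + k | b k. b \<in> B \<and> k \<in> K}"
  have S: "compact ?S"
    by (rule compact_sum_set[OF B K(1)])
  \<comment> \<open>Only t carries the indicator of B; multiplying by the indicator of B at s
    recovers the empirical integrand.\<close>
  define E where "E s t = indicator B t * \<phi> (s - t) * cnj (orb t x) * orb s x" for s t
  have [measurable]: "(\<lambda>(s, t). E s t) \<in> borel_measurable (borel \<Otimes>\<^sub>M borel)"
    unfolding E_def by measurable
  have E_le: "norm (E s t) \<le> M * M * norm (\<phi> (s - t))" for s t
  proof -
    have "norm (E s t) \<le> (1 * norm (\<phi> (s - t)) * M) * M"
      unfolding E_def norm_mult using M
      by (intro mult_mono) (auto simp: indicator_def)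
    then show ?thesis
      by (simp add: ac_simps)
  qed
  have E_le_const: "norm (E s t) \<le> M * M * C" for s t
  proof -
    have "M * M * norm (\<phi> (s - t)) \<le> M * M * C"
      using C M by (intro mult_left_mono) auto
    then show ?thesis
      using E_le[of s t] by simp
  qed
  have E_0: "E s t = 0" if "s \<notin> ?S \<or> t \<notin> B" for s t
  proof (cases "t \<in> B \<and> s - t \<in> K")
    case True
    moreover have "s = t + (s - t)"
      by simp
    ultimately have "s \<in> ?S"
      by blast
    then show ?thesis
      using True that by simp
  next
    case False
    then show ?thesis
      using K(2) by (auto simp: E_def)
  qed
  have E_bound: "norm (E s t) \<le> (M * M * C) * indicator ?S s * indicator B t" for s t
  proof (cases "s \<in> ?S \<and> t \<in> B")
    case True
    then show ?thesis
      using E_le_const[of s t] by simp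
  next
    case False
    then have "E s t = 0"
      using E_0 by blast
    then show ?thesis
      using M C by simp
  qed
  have intE: "integrable (mG \<Otimes>\<^sub>M mG) (\<lambda>(s, t). E s t)"
    using E_bound by (intro integrable_pair_compact[OF _ S B]) auto
  have intE': "integrable (mG \<Otimes>\<^sub>M mG) (\<lambda>(s, t). indicator B s * E s t)"
  proof (intro integrable_pair_compact[OF _ S B])
    show "(\<lambda>(s, t). indicator B s * E s t) \<in> borel_measurable (borel \<Otimes>\<^sub>M borel)"
      by measurable
    show "norm (case (s, t) of (s, t) \<Rightarrow> indicator B s * E s t) \<le> M * M * C * indicator ?S s * indicator B t" for s t
      using E_bound[of s t] order_trans[OF norm_ge_zero E_bound[of s t]] by (cases "s \<in> B") auto
  qed
  have emp: "empirical_autocorrelation mG \<alpha> f x B \<phi>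
      = complex_of_real (1 / measure mG B) * (LINT s|mG. (LINT t|mG. indicator B s * E s t))"
    by (simp add: empirical_autocorrelation_eq E_def mult.assoc)
  have avg: "(LINT u|mG. \<phi> u * orbit_average B u x)
      = complex_of_real (1 / measure mG B) * (LINT s|mG. (LINT t|mG. E s t))"
  proof -
    let ?F = "\<lambda>u t. indicator B t * \<phi> u * cnj (orb t x) * orb (u + t) x"
    have "\<phi> u * orbit_average B u x = complex_of_real (1 / measure mG B) * (LINT t|mG. ?F u t)" for u
    proof -
      have "\<phi> u * (LINT t|mG. indicator B t *\<^sub>R (orb (u + t) x * cnj (orb t x))) = (LINT t|mG. ?F u t)"
        unfolding integral_mult_right_zero[symmetric]
        by (intro Bochner_Integration.integral_cong) (auto simp: indicator_def)
      then show ?thesis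
        by (simp add: orbit_average_def)
    qed
    then have "(LINT u|mG. \<phi> u * orbit_average B u x)
        = complex_of_real (1 / measure mG B) * (LINT u|mG. (LINT t|mG. ?F u t))"
      by simp
    also have "(LINT u|mG. (LINT t|mG. ?F u t)) = (LINT t|mG. (LINT u|mG. ?F u t))"
    proof (rule GG.Fubini_integral[symmetric])
      show "integrable (mG \<Otimes>\<^sub>M mG) (\<lambda>(u, t). ?F u t)"
      proof (rule GG.integrable_product_bound[where a = "\<lambda>u. norm (\<phi> u)" and b = "\<lambda>t. (M * M) * indicator B t"])
        show "norm (case (u, t) of (u, t) \<Rightarrow> ?F u t) \<le> norm (\<phi> u) * (M * M * indicator B t)" for u t
          using M by (auto simp: norm_mult indicator_def mult.assoc intro!: mult_left_mono mult_mono)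
      qed (use integrable_Cc[OF \<phi>] integrable_indicator_compact[OF B] in auto)
    qed
    \<comment> \<open>For fixed t substitute s = u + t.\<close>
    also have "\<dots> = (LINT t|mG. (LINT s|mG. E s t))"
    proof (rule Bochner_Integration.integral_cong[OF refl])
      fix t
      show "(LINT u|mG. ?F u t) = (LINT s|mG. E s t)"
        using integral_translation[of "\<lambda>s. E s t" t] by (simp add: E_def add.commute)
    qed
    \<comment> \<open>The order is exchanged again so that s is the outer variable and the boundary
      can be isolated in it.\<close>
    also have "\<dots> = (LINT s|mG. (LINT t|mG. E s t))"
      by (rule GG.Fubini_integral[OF intE])
    finally show ?thesis .
  qed
  \<comment> \<open>Integrability of every section, not just of almost every one, allows the inner
    difference to be rewritten at each s.\<close>
  have sect: "integrable mG (\<lambda>t. E s t)" for s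
  proof (rule Bochner_Integration.integrable_bound)
    show "integrable mG (\<lambda>t. (M * M * C) * indicator B t :: real)"
      by (rule integrable_indicator_compact[OF B])
    have "norm (E s t) \<le> norm (M * M * C * indicator B t)" for t
      using E_le_const[of s t] E_0[of s t] M C by (cases "t \<in> B") auto
    then show "AE t in mG. norm (E s t) \<le> norm (M * M * C * indicator B t)"
      by simp
    show "(\<lambda>t. E s t) \<in> borel_measurable mG"
      unfolding E_def by measurable
  qed
  let ?N = "LINT u|mG. norm (\<phi> u)"
  have inner: "norm (LINT t|mG. E s t - indicator B s * E s t) \<le> M * M * ?N * indicator ?V s" for s
  proof (cases "s \<in> ?V")
    case True
    have "(LINT t|mG. norm (\<phi> (s - t))) = ?N"
      using integral_inversion[of "\<lambda>t. norm (\<phi> (s + t))"] integral_translation[of "\<lambda>t. norm (\<phi> t)" s] by simp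
    moreover have "integrable mG (\<lambda>t. norm (\<phi> (s - t)))"
      using integrable_inversion[of "\<lambda>t. norm (\<phi> (s + t))"] integrable_translation[of "\<lambda>t. norm (\<phi> t)" s]
        integrable_Cc[OF \<phi>] by simp
    moreover have "norm (E s t - indicator B s * E s t) \<le> M * M * norm (\<phi> (s - t))" for t
      using E_le[of s t] M by (auto simp: indicator_def)
    ultimately have "norm (LINT t|mG. E s t - indicator B s * E s t) \<le> M * M * ?N"
      using norm_integral_le[of mG "\<lambda>t. M * M * norm (\<phi> (s - t))" "\<lambda>t. E s t - indicator B s * E s t"] by simp
    then show ?thesis
      using True M by (auto simp: indicator_def)
  next
    case False
    have "?S - B \<subseteq> ?V"
      unfolding van_Hove_boundary_def using closure_subset[of "?S - B"] by blast
    \<comment> \<open>Off the boundary, s in B makes the two integrands equal, and s outside B + K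
      makes both vanish.\<close>
    with False have "s \<in> B \<or> s \<notin> ?S"
      by blast
    then have "E s t - indicator B s * E s t = 0" for t
      using E_0[of s t] by (cases "s \<in> B") auto
    then have "(LINT t|mG. E s t - indicator B s * E s t) = 0"
      by (simp only: Bochner_Integration.integral_zero)
    then show ?thesis
      using False by simp
  qed
  have "(LINT s|mG. (LINT t|mG. E s t)) - (LINT s|mG. (LINT t|mG. indicator B s * E s t))
      = (LINT s|mG. (LINT t|mG. E s t) - (LINT t|mG. indicator B s * E s t))"
    using GG.integrable_fst'[OF intE] GG.integrable_fst'[OF intE'] by (simp only: prod.case Bochner_Integration.integral_diff)
  also have "\<dots> = (LINT s|mG. (LINT t|mG. E s t - indicator B s * E s t))"
    using sect by (simp add: Bochner_Integration.integral_diff)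
  also have "norm \<dots> \<le> (LINT s|mG. M * M * ?N * indicator ?V s)"
    by (rule norm_integral_le[OF integrable_indicator_compact[OF V] inner])
  also have "\<dots> = M * M * ?N * measure mG ?V"
    using compact_sets[OF V] by simp
  finally have "norm ((LINT s|mG. (LINT t|mG. E s t)) - (LINT s|mG. (LINT t|mG. indicator B s * E s t)))
      \<le> M * M * ?N * measure mG ?V" .
  then have "1 / measure mG B * norm ((LINT s|mG. (LINT t|mG. E s t)) - (LINT s|mG. (LINT t|mG. indicator B s * E s t)))
      \<le> 1 / measure mG B * (M * M * ?N * measure mG ?V)"
    by (intro mult_left_mono) auto
  then show ?thesis
    unfolding emp avg right_diff_distrib[symmetric] norm_mult norm_of_real by (simp add: mult.commute)
qed

section \<open>Vague convergence\<close>

text \<open>The point x is fixed and \<open>lim\<close> does not mention \<phi>, so one exceptional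
  null set of points x serves all test functions. The compact set K in the van Hove estimate may
  depend on \<phi>.\<close>

lemma empirical_autocorrelation_vaguely_converges:
  assumes vH: "van_Hove_sequence mG B"
    and lim: "AE u in mG. (\<lambda>n. orbit_average (B n) u x) \<longlonglongrightarrow> corr u"
  shows "vaguely_converges (\<lambda>n. empirical_autocorrelation mG \<alpha> f x (B n)) (autocorrelation mG \<alpha> m f)"
  unfolding vaguely_converges_def
proof
  fix \<phi> :: "'g \<Rightarrow> complex" assume \<phi>: "\<phi> \<in> Cc"
  have B: "compact (B n)" "measure mG (B n) > 0" for n
    using vH by (auto simp: van_Hove_sequence_def)
  obtain K C where K: "compact K" "\<And>t. t \<notin> K \<Longrightarrow> \<phi> t = 0"
    using CcE[OF \<phi>] by metis
  obtain M where M: "0 \<le> M" "\<And>x. norm (f x) \<le> M" "\<And>t x. norm (orb t x) \<le> M"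
    using orb_bounded by metis
  let ?D = "\<lambda>n. (LINT u|mG. \<phi> u * orbit_average (B n) u x)"
  let ?e = "\<lambda>n. empirical_autocorrelation mG \<alpha> f x (B n) \<phi>"
  have "(\<lambda>n. measure mG (van_Hove_boundary K (B n)) / measure mG (B n)) \<longlonglongrightarrow> 0"
    using vH K(1) by (simp add: van_Hove_sequence_def)
  then have "(\<lambda>n. M * M * (LINT u|mG. norm (\<phi> u)) * (measure mG (van_Hove_boundary K (B n)) / measure mG (B n))) \<longlonglongrightarrow> 0"
    by (rule tendsto_mult_right_zero)
  moreover have "\<forall>\<^sub>F n in sequentially. norm (?D n - ?e n)
      \<le> M * M * (LINT u|mG. norm (\<phi> u)) * (measure mG (van_Hove_boundary K (B n)) / measure mG (B n))"
    by (intro always_eventually allI empirical_autocorrelation_approx \<phi> K B M)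
  ultimately have "(\<lambda>n. ?D n - ?e n) \<longlonglongrightarrow> 0"
    by (rule Lim_null_comparison[rotated])
  moreover have "?D \<longlonglongrightarrow> (LINT u|mG. \<phi> u * corr u)"
    by (rule orbit_average_dominated[OF \<phi> B lim])
  ultimately have "(\<lambda>n. ?D n - (?D n - ?e n)) \<longlonglongrightarrow> (LINT u|mG. \<phi> u * corr u) - 0"
    by (intro tendsto_diff)
  then show "?e \<longlonglongrightarrow> autocorrelation mG \<alpha> m f \<phi>"
    by (simp add: autocorrelation_eq[OF \<phi>])
qed

end

theorem theorem4p8:
  fixes mG :: "'g::{topological_ab_group_add, t2_space, second_countable_topology} measure"
    and \<alpha> :: "'g \<Rightarrow> 'x::t2_space \<Rightarrow> 'x"
    and m :: "'x measure"
    and B :: "nat \<Rightarrow> 'g set"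
    and f :: "'x \<Rightarrow> complex"
  assumes "locally_compact_space (euclidean :: 'g topology)"
    and "sigma_compact (UNIV :: 'g set)"
    and "haar_measure mG"
    and "ergodic_system \<alpha> m"
    and "van_Hove_sequence mG B"
    and "birkhoff_along mG \<alpha> m B"
    and "continuous_on UNIV f"
  shows "AE x in m. vaguely_converges
           (\<lambda>n. empirical_autocorrelation mG \<alpha> f x (B n)) (autocorrelation mG \<alpha> m f)"
proof -
  interpret haar_system mG \<alpha> m f
    using assms by unfold_locales (auto simp: ergodic_system_def)
  have "compact (B n)" for n
    using assms(5) by (simp add: van_Hove_sequence_def)
  from AE_orbit_average_tendsto[OF assms(6) this] show ?thesis
    by eventually_elim (rule empirical_autocorrelation_vaguely_converges[OF assms(5)])
qed

end
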